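(* Let $G$ be a finite graph (loopless, multiple edges allowed) that contains $4$ pairwise edge-disjoint spanning trees. Then $G$ is $\mathbb{Z}_3$-connected.
   Context: Graphs are finite, have no loops, and may have multiple edges. For an orientation $D$ of $G$, $d_D^+(v)$ and $d_D^-(v)$ denote the out-degree and in-degree of the vertex $v$. A zero-sum function of $G$ is a map $\beta: V(G)\to\mathbb{Z}_3$ with $\sum_{v\in V(G)}\beta(v)=0$ in $\mathbb{Z}_3$. A $\beta$-orientation of $G$ is an orientation $D$ of $G$ with $d_D^+(v)-d_D^-(v)=\beta(v)$ in $\mathbb{Z}_3$ for every $v\in V(G)$. $G$ is $\mathbb{Z}_3$-connected if it admits a $\beta$-orientation for every zero-sum function $\beta$ of $G$. *)

theory Defs
  imports "HOL-Library.Numeral_Type" "Graph_Theory.Digraph"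
begin

text \<open>
  Undirected multigraphs: edges are named objects, so distinct elements of
  \<open>medges G\<close> may have the same set of ends.
  (The library digraphs carry a direction on every arc, and the library predicate
  \<open>spanning_tree\<close> only excludes directed cycles, so it does not describe trees
  of undirected graphs.)
\<close>

record ('a, 'e) multigraph =
  mverts :: "'a set"
  medges :: "'e set"
  mends :: "'e \<Rightarrow> 'a set"

locale fin_loopless_multigraph =
  fixes G :: "('a, 'e) multigraph"
  assumes finite_mverts: "finite (mverts G)"
    and finite_medges: "finite (medges G)"
    and mends_subset: "e \<in> medges G \<Longrightarrow> mends G e \<subseteq> mverts G"
    and card_mends: "e \<in> medges G \<Longrightarrow> card (mends G e) = 2"

text \<open>
  A walk from \<open>u\<close> is the list of its steps \<open>(e, w)\<close>: traverse the edge \<open>e\<close> to reach \<open>w\<close>.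
\<close>

fun mwalk :: "('a, 'e) multigraph \<Rightarrow> 'a \<Rightarrow> ('e \<times> 'a) list \<Rightarrow> 'a \<Rightarrow> bool" where
  "mwalk G u [] v \<longleftrightarrow> u \<in> mverts G \<and> u = v"
| "mwalk G u ((e, w) # p) v \<longleftrightarrow>
     u \<in> mverts G \<and> e \<in> medges G \<and> mends G e = {u, w} \<and> mwalk G w p v"

definition mconnected :: "('a, 'e) multigraph \<Rightarrow> bool" where
  "mconnected G \<longleftrightarrow>
     mverts G \<noteq> {} \<and> (\<forall>u\<in>mverts G. \<forall>v\<in>mverts G. \<exists>p. mwalk G u p v)"

text \<open>
  Two parallel edges form a cycle of length 2; distinctness of the edges keeps
  the walk back and forth along a single edge from being a cycle.
\<close>

definition mcycle :: "('a, 'e) multigraph \<Rightarrow> 'a \<Rightarrow> ('e \<times> 'a) list \<Rightarrow> bool" where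
  "mcycle G u p \<longleftrightarrow>
     p \<noteq> [] \<and> mwalk G u p u \<and> distinct (map fst p) \<and> distinct (map snd p)"

definition mtree :: "('a, 'e) multigraph \<Rightarrow> bool" where
  "mtree G \<longleftrightarrow> mconnected G \<and> \<not> (\<exists>u p. mcycle G u p)"

definition msubgraph :: "('a, 'e) multigraph \<Rightarrow> ('a, 'e) multigraph \<Rightarrow> bool" where
  "msubgraph H G \<longleftrightarrow>
     mverts H \<subseteq> mverts G \<and> medges H \<subseteq> medges G \<and>
     (\<forall>e\<in>medges H. mends H e = mends G e \<and> mends H e \<subseteq> mverts H)"

definition mspanning_tree :: "('a, 'e) multigraph \<Rightarrow> ('a, 'e) multigraph \<Rightarrow> bool" where
  "mspanning_tree T G \<longleftrightarrow> msubgraph T G \<and> mverts T = mverts G \<and> mtree T"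

text \<open>
  The trees form an indexed family, so on one vertex the edgeless tree may be repeated.
\<close>

definition has_edge_disjoint_spanning_trees :: "nat \<Rightarrow> ('a, 'e) multigraph \<Rightarrow> bool" where
  "has_edge_disjoint_spanning_trees k G \<longleftrightarrow>
     (\<exists>T. (\<forall>i<k. mspanning_tree (T i) G) \<and>
          (\<forall>i<k. \<forall>j<k. i \<noteq> j \<longrightarrow> medges (T i) \<inter> medges (T j) = {}))"

definition orientation :: "('a, 'e) pre_digraph \<Rightarrow> ('a, 'e) multigraph \<Rightarrow> bool" where
  "orientation D G \<longleftrightarrow>
     verts D = mverts G \<and> arcs D = medges G \<and>
     (\<forall>e\<in>medges G. mends G e = {tail D e, head D e})"

text \<open>
  \<open>\<int>\<^sub>3\<close> is the ring type \<open>3\<close> of integers modulo 3; only the values of \<open>\<beta>\<close> on the vertices matter.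
\<close>

definition zero_sum :: "('a, 'e) multigraph \<Rightarrow> ('a \<Rightarrow> 3) \<Rightarrow> bool" where
  "zero_sum G \<beta> \<longleftrightarrow> (\<Sum>v\<in>mverts G. \<beta> v) = 0"

definition beta_orientation ::
    "('a, 'e) multigraph \<Rightarrow> ('a \<Rightarrow> 3) \<Rightarrow> ('a, 'e) pre_digraph \<Rightarrow> bool" where
  "beta_orientation G \<beta> D \<longleftrightarrow>
     orientation D G \<and>
     (\<forall>v\<in>mverts G. of_nat (out_degree D v) - of_nat (in_degree D v) = \<beta> v)"

definition Z3_connected :: "('a, 'e) multigraph \<Rightarrow> bool" where
  "Z3_connected G \<longleftrightarrow> (\<forall>\<beta>. zero_sum G \<beta> \<longrightarrow> (\<exists>D. beta_orientation G \<beta> D))"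

end

(* Induct on the number of vertices. If some edge cut has at most five edges, then four disjoint
   connected spanning edge sets stay connected on one side B of it. If B has at least two
   vertices, B is contracted. If B is a single vertex x, at most one of the four sets has two
   edges at x; these are split off to an edge avoiding x, and the (at least two) remaining edges
   at x realise any prescribed residue there. If all cuts have at least six edges, the theorem of
   Lovasz, Thomassen, Wu and Zhang on 6-edge-connected graphs applies. Its inductive form
   concerns a graph with a vertex z0 all of whose edges are already oriented. *)
theory Submission
  imports Defs
begin

section \<open>Orientations with prescribed net outflow modulo 3\<close>

text \<open>The two halves meet at cut size six. Four disjoint connected sets put at least four
  edges into every cut, so a cut of at most five edges has room for one extra edge, and only the set
  that owns it can fall apart on a side. Connected sets replace trees because contraction may
  destroy acyclicity but not connectedness. 6-edge-connectivity does not survive the deletion of an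
  edge, so it cannot serve as induction hypothesis. Instead, every proper vertex set must have
  degree at least four plus the least absolute net outflow that its prescription admits. This least
  value is at most 3, and parity lets cuts of six edges satisfy the bound. Singletons may meet the
  bound with equality, larger sets may not: a larger tight set splits the problem into its
  contraction and its inside, and the directions already chosen on its boundary are what the
  oriented vertex \<open>z0\<close> stands for. The upper bound on the degree of \<open>z0\<close>
  is the one that a tight set delivers.\<close>

text \<open>The ends of an edge \<open>e\<close> are \<open>u e\<close> and \<open>v e\<close>, in an arbitrary reference order; an orientation is a sign
  function \<open>w\<close>, where \<open>w e = 1\<close> directs \<open>e\<close> from \<open>u e\<close> to \<open>v e\<close>. Loops are allowed, they
  contribute neither to \<open>net\<close> nor to \<open>cut_size\<close>.\<close>

definition net :: "'e set \<Rightarrow> ('e \<Rightarrow> 'v) \<Rightarrow> ('e \<Rightarrow> 'v) \<Rightarrow> ('e \<Rightarrow> int) \<Rightarrow> 'v \<Rightarrow> int" where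
  "net E u v w x = (\<Sum>e\<in>E. w e * (of_bool (u e = x) - of_bool (v e = x)))"

definition cut_size :: "'e set \<Rightarrow> ('e \<Rightarrow> 'v) \<Rightarrow> ('e \<Rightarrow> 'v) \<Rightarrow> 'v set \<Rightarrow> int" where
  "cut_size E u v A = (\<Sum>e\<in>E. of_bool ((u e \<in> A) \<noteq> (v e \<in> A)))"

text \<open>Prescriptions are integers rather than residues modulo 3, because the 6-edge-connected
  case picks representatives of the right parity.\<close>

definition orientable :: "'v set \<Rightarrow> 'e set \<Rightarrow> ('e \<Rightarrow> 'v) \<Rightarrow> ('e \<Rightarrow> 'v) \<Rightarrow> ('v \<Rightarrow> int) \<Rightarrow> bool" where
  "orientable V E u v s \<longleftrightarrow>
     (\<exists>w. (\<forall>e. w e = 1 \<or> w e = -1) \<and> (\<forall>x\<in>V. 3 dvd net E u v w x - s x))"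

definition induced :: "'e set \<Rightarrow> ('e \<Rightarrow> 'v) \<Rightarrow> ('e \<Rightarrow> 'v) \<Rightarrow> 'v set \<Rightarrow> 'e set" where
  "induced E u v A = {e \<in> E. u e \<in> A \<and> v e \<in> A}"

definition collapse :: "'v set \<Rightarrow> 'v \<Rightarrow> 'v \<Rightarrow> 'v" where
  "collapse A a z = (if z \<in> A then a else z)"

definition add_at :: "'v \<Rightarrow> int \<Rightarrow> ('v \<Rightarrow> int) \<Rightarrow> 'v \<Rightarrow> int" where
  "add_at x c f z = f z + (if z = x then c else 0)"

section \<open>Parity and bookkeeping for net outflow and cuts\<close>

lemma sum_add_at: "finite A \<Longrightarrow> sum (add_at x c f) A = sum f A + (if x \<in> A then c else 0)"
  unfolding add_at_def by (simp add: sum.distrib)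

lemma sum_of_bool_singleton: "finite A \<Longrightarrow> (\<Sum>x\<in>A. of_bool (y = x)) = (of_bool (y \<in> A) :: int)"
  by (simp add: of_bool_def)

lemma sum_net:
  assumes "finite A"
  shows "(\<Sum>x\<in>A. net E u v w x) = (\<Sum>e\<in>E. w e * (of_bool (u e \<in> A) - of_bool (v e \<in> A)))"
  unfolding net_def
  by (subst sum.swap)
    (simp del: sum_of_bool_eq sum_mult_of_bool_eq
      add: sum_distrib_left[symmetric] sum_subtractf sum_of_bool_singleton assms)

text \<open>A crossing edge adds an odd number to both terms and any other edge adds nothing, so net
  outflow and degree agree modulo 2.\<close>

lemma even_net_cut:
  assumes "\<forall>e. w e = 1 \<or> w e = (-1::int)" "finite A"
  shows "even ((\<Sum>x\<in>A. net E u v w x) + cut_size E u v A)"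
  unfolding sum_net[OF assms(2)] cut_size_def sum.distrib[symmetric]
proof (rule dvd_sum)
  fix e assume "e \<in> E"
  show "even (w e * (of_bool (u e \<in> A) - of_bool (v e \<in> A)) + of_bool ((u e \<in> A) \<noteq> (v e \<in> A)))"
    using assms(1)[rule_format, of e] by auto
qed

lemma even_cut_sum:
  assumes "finite A"
  shows "even (cut_size E u v A + (\<Sum>x\<in>A. cut_size E u v {x}))"
proof -
  have a: "even ((\<Sum>x\<in>A. net E u v (\<lambda>_. 1) x) + cut_size E u v A)"
    using even_net_cut[of "\<lambda>_. 1" A] assms by simp
  have "even (\<Sum>x\<in>A. net E u v (\<lambda>_. 1) x + cut_size E u v {x})"
    using even_net_cut[of "\<lambda>_. 1" "{_}"] by (intro dvd_sum) simp
  with a show ?thesis by (simp add: sum.distrib)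
qed

lemma cut_remove:
  "finite E \<Longrightarrow> e \<in> E \<Longrightarrow>
    cut_size (E - {e}) u v A = cut_size E u v A - of_bool ((u e \<in> A) \<noteq> (v e \<in> A))"
  unfolding cut_size_def by (simp add: sum.remove[of E e] del: sum_of_bool_eq)

lemma net_remove:
  "finite E \<Longrightarrow> e \<in> E \<Longrightarrow>
    net E u v w x = net (E - {e}) u v w x + w e * (of_bool (u e = x) - of_bool (v e = x))"
  unfolding net_def by (subst sum.remove[of E e]) auto

lemma cut_cong: "(\<And>e. e \<in> E \<Longrightarrow> u e = u' e \<and> v e = v' e) \<Longrightarrow> cut_size E u v A = cut_size E u' v' A"
  unfolding cut_size_def by (auto intro!: sum.cong)

lemma net_cong:
  "(\<And>e. e \<in> E \<Longrightarrow> u e = u' e \<and> v e = v' e \<and> w e = w' e) \<Longrightarrow> net E u v w x = net E u' v' w' x"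
  unfolding net_def by (auto intro!: sum.cong)

lemma cut_nonneg: "0 \<le> cut_size E u v A"
  unfolding cut_size_def by (rule sum_nonneg) auto

lemma cut_eq_card:
  "finite E \<Longrightarrow> cut_size E u v A = int (card {e \<in> E. (u e \<in> A) \<noteq> (v e \<in> A)})"
  unfolding cut_size_def by (simp add: of_bool_def sum.If_cases Int_def)

lemma cut_ge_2E:
  assumes "finite E" "2 \<le> cut_size E u v A"
  obtains e f where "e \<in> E" "f \<in> E" "e \<noteq> f" "(u e \<in> A) \<noteq> (v e \<in> A)" "(u f \<in> A) \<noteq> (v f \<in> A)"
proof -
  have "2 \<le> card {e \<in> E. (u e \<in> A) \<noteq> (v e \<in> A)}"
    using assms by (simp add: cut_eq_card)
  then show thesis
    using that by (auto simp: card_le_Suc_iff numeral_2_eq_2)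
qed

lemma cut_pos_iff: "finite E \<Longrightarrow> 1 \<le> cut_size E u v A \<longleftrightarrow> (\<exists>e\<in>E. (u e \<in> A) \<noteq> (v e \<in> A))"
  by (auto simp: cut_eq_card Suc_le_eq card_gt_0_iff)

lemma cut_compl:
  "(\<And>e. e \<in> E \<Longrightarrow> u e \<in> V \<and> v e \<in> V) \<Longrightarrow> cut_size E u v (V - A) = cut_size E u v A"
  unfolding cut_size_def by (rule sum.cong) auto

section \<open>Lifting orientations through deletion, splitting and contraction\<close>

lemma orientable_mod:
  assumes "orientable V E u v s" "\<And>x. x \<in> V \<Longrightarrow> 3 dvd s x - s' x"
  shows "orientable V E u v s'"
proof -
  obtain w where w: "\<forall>e. w e = 1 \<or> w e = -1" "\<forall>x\<in>V. 3 dvd net E u v w x - s x"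
    using assms(1) unfolding orientable_def by blast
  have "3 dvd net E u v w x - s' x" if "x \<in> V" for x
    using dvd_add[OF w(2)[rule_format, OF that] assms(2)[OF that]] by simp
  with w(1) show ?thesis unfolding orientable_def by blast
qed

text \<open>The edge is put back directed from x to y, so the rest must deliver one unit less at x
  and one more at y. The case x = y covers loops.\<close>

lemma orientable_delete:
  assumes "finite E" "e \<in> E" "{u e, v e} = {x, y}"
    and "orientable V (E - {e}) u v (add_at y 1 (add_at x (-1) s))"
  shows "orientable V E u v s"
proof -
  obtain w where w: "\<forall>e. w e = 1 \<or> w e = -1"
    "\<forall>z\<in>V. 3 dvd net (E - {e}) u v w z - (add_at y 1 (add_at x (-1) s) z)"
    using assms(4) unfolding orientable_def by blast
  define w' where "w' = w(e := if u e = x then 1 else -1)"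
  have "net E u v w' z - s z
      = net (E - {e}) u v w z - add_at y 1 (add_at x (-1) s) z" for z
  proof -
    have "net (E - {e}) u v w' z = net (E - {e}) u v w z"
      by (rule net_cong) (auto simp: w'_def)
    moreover have "w' e * (of_bool (u e = z) - of_bool (v e = z)) = of_bool (z = x) - of_bool (z = y)"
      using assms(3) by (auto simp: w'_def doubleton_eq_iff)
    ultimately show ?thesis
      using net_remove[OF assms(1,2), of u v w' z] by (simp add: add_at_def)
  qed
  moreover have "\<forall>e. w' e = 1 \<or> w' e = -1" using w(1) by (simp add: w'_def)
  ultimately show ?thesis unfolding orientable_def using w(2) by metis
qed

text \<open>The name \<open>e\<close> is reused for the new edge ab. Its direction lifts to a path
  through x, which has net outflow zero at x.\<close>

lemma orientable_split:
  assumes "finite E" "e \<in> E" "f \<in> E" "e \<noteq> f" "{u e, v e} = {x, a}" "{u f, v f} = {x, b}"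
    and "orientable V (E - {f}) (u(e := a)) (v(e := b)) s"
  shows "orientable V E u v s"
proof -
  obtain w where w: "\<forall>e. w e = 1 \<or> w e = -1"
    "\<forall>z\<in>V. 3 dvd net (E - {f}) (u(e := a)) (v(e := b)) w z - s z"
    using assms(7) unfolding orientable_def by blast
  define w' where "w' = w(e := if u e = a then w e else - w e, f := if u f = b then - w e else w e)"
  have "net E u v w' z = net (E - {f}) (u(e := a)) (v(e := b)) w z" for z
  proof -
    let ?D = "E - {f} - {e}"
    have D: "net ?D u v w' z = net ?D (u(e := a)) (v(e := b)) w z"
      by (rule net_cong) (auto simp: w'_def)
    have "net E u v w' z = net ?D u v w' z
        + w' e * (of_bool (u e = z) - of_bool (v e = z)) + w' f * (of_bool (u f = z) - of_bool (v f = z))"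
      using net_remove[of E f u v w' z] net_remove[of "E - {f}" e u v w' z] assms(1-4) by auto
    moreover have "w' e * (of_bool (u e = z) - of_bool (v e = z)) = w e * (of_bool (a = z) - of_bool (x = z))"
      using assms(4,5) by (auto simp: w'_def doubleton_eq_iff)
    moreover have "w' f * (of_bool (u f = z) - of_bool (v f = z)) = w e * (of_bool (x = z) - of_bool (b = z))"
      using assms(4,6) by (auto simp: w'_def doubleton_eq_iff)
    moreover have "net (E - {f}) (u(e := a)) (v(e := b)) w z = net ?D (u(e := a)) (v(e := b)) w z
        + w e * (of_bool (a = z) - of_bool (b = z))"
      using net_remove[of "E - {f}" e "u(e := a)" "v(e := b)" w z] assms(1-4) by auto
    ultimately show ?thesis using D by (simp add: algebra_simps)
  qed
  moreover have "\<forall>e. w' e = 1 \<or> w' e = -1" using w(1) by (simp add: w'_def) (metis minus_minus)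
  ultimately show ?thesis unfolding orientable_def using w(2) by metis
qed

lemma cut_split:
  assumes "finite E" "e \<in> E" "f \<in> E" "e \<noteq> f" "{u e, v e} = {x, a}" "{u f, v f} = {x, b}"
  shows "cut_size (E - {f}) (u(e := a)) (v(e := b)) A = cut_size E u v A
    - of_bool ((x \<in> A) \<noteq> (a \<in> A)) - of_bool ((x \<in> A) \<noteq> (b \<in> A)) + of_bool ((a \<in> A) \<noteq> (b \<in> A))"
proof -
  let ?D = "E - {f} - {e}"
  have "cut_size ?D (u(e := a)) (v(e := b)) A = cut_size ?D u v A"
    by (rule cut_cong) auto
  moreover have "cut_size ?D u v A = cut_size E u v A - of_bool ((x \<in> A) \<noteq> (a \<in> A)) - of_bool ((x \<in> A) \<noteq> (b \<in> A))"
    using assms by (auto simp: cut_remove doubleton_eq_iff)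
  ultimately show ?thesis
    using cut_remove[of "E - {f}" e "u(e := a)" "v(e := b)" A] assms by simp
qed

lemma orientable_isolated:
  assumes "orientable (V - {x}) E u v s" "\<And>e. e \<in> E \<Longrightarrow> u e \<noteq> x \<and> v e \<noteq> x" "3 dvd s x"
  shows "orientable V E u v s"
proof -
  obtain w where w: "\<forall>e. w e = 1 \<or> w e = -1" "\<forall>z\<in>V - {x}. 3 dvd net E u v w z - s z"
    using assms(1) unfolding orientable_def by blast
  have "net E u v w x = 0" unfolding net_def using assms(2) by (intro sum.neutral) auto
  with w assms(3) have "\<forall>z\<in>V. 3 dvd net E u v w z - s z" by (metis DiffI diff_0 dvd_minus_iff singletonD)
  with w(1) show ?thesis unfolding orientable_def by blast
qed

text \<open>Only edges inside A are redirected, which changes nothing at vertices outside A; the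
  directions of \<open>w\<close> on all other edges enter the inner prescription as a
  correction.\<close>

lemma orientable_glue:
  assumes "finite E" "\<forall>e. w e = 1 \<or> w e = (-1::int)"
    and out: "\<And>x. x \<in> V - A \<Longrightarrow> 3 dvd net E u v w x - s x"
    and inner: "orientable A (induced E u v A) u v (\<lambda>x. s x - net (E - induced E u v A) u v w x)"
  shows "orientable V E u v s"
proof -
  let ?I = "induced E u v A"
  obtain w1 where w1: "\<forall>e. w1 e = 1 \<or> w1 e = -1"
    "\<forall>x\<in>A. 3 dvd net ?I u v w1 x - (s x - net (E - ?I) u v w x)"
    using inner unfolding orientable_def by blast
  define w' where "w' e = (if e \<in> ?I then w1 e else w e)" for e
  have split: "net E u v f x = net ?I u v f x + net (E - ?I) u v f x" for f x
    unfolding net_def using assms(1) by (subst sum.subset_diff[of ?I E]) (auto simp: induced_def)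
  have i: "net ?I u v w' x = net ?I u v w1 x" for x by (rule net_cong) (auto simp: w'_def)
  have o: "net (E - ?I) u v w' x = net (E - ?I) u v w x" for x by (rule net_cong) (auto simp: w'_def)
  have z: "net ?I u v f x = 0" if "x \<notin> A" for f x
    unfolding net_def using that by (intro sum.neutral) (auto simp: induced_def)
  have "3 dvd net E u v w' x - s x" if "x \<in> V" for x
  proof (cases "x \<in> A")
    case True
    then show ?thesis using w1(2) split[of w' x] i[of x] o[of x] by (simp add: algebra_simps)
  next
    case False
    then show ?thesis using out[of x] that split[of w' x] split[of w x] o[of x] z[of x] by simp
  qed
  moreover have "\<forall>e. w' e = 1 \<or> w' e = -1" using w1(1) assms(2) by (simp add: w'_def)
  ultimately show ?thesis unfolding orientable_def by blast
qed

lemma net_collapse_outside: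
  "a \<in> A \<Longrightarrow> x \<notin> A \<Longrightarrow> net E (collapse A a \<circ> u) (collapse A a \<circ> v) w x = net E u v w x"
  unfolding net_def collapse_def by (rule sum.cong) auto

lemma net_collapse_rep:
  assumes "finite E" "finite A" "a \<in> A"
  shows "net E (collapse A a \<circ> u) (collapse A a \<circ> v) w a = (\<Sum>x\<in>A. net (E - induced E u v A) u v w x)"
proof -
  have "net E (collapse A a \<circ> u) (collapse A a \<circ> v) w a
      = (\<Sum>e\<in>E. w e * (of_bool (u e \<in> A) - of_bool (v e \<in> A)))"
    unfolding net_def collapse_def using assms(3) by (intro sum.cong) auto
  also have "\<dots> = (\<Sum>e\<in>E - induced E u v A. w e * (of_bool (u e \<in> A) - of_bool (v e \<in> A)))"
    using assms(1) by (intro sum.mono_neutral_right) (auto simp: induced_def)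
  finally show ?thesis by (simp add: sum_net assms(2))
qed

text \<open>The set on the right is the preimage of B under the collapse: cuts after contraction are
  the original cuts that do not divide A.\<close>

lemma cut_collapse:
  "a \<in> A \<Longrightarrow> cut_size E (collapse A a \<circ> u) (collapse A a \<circ> v) B = cut_size E u v (if a \<in> B then B \<union> A else B - A)"
  unfolding cut_size_def collapse_def by (rule sum.cong) auto

definition merge :: "'v set \<Rightarrow> 'v \<Rightarrow> ('v \<Rightarrow> int) \<Rightarrow> 'v \<Rightarrow> int" where
  "merge A a s z = (if z = a then sum s A else s z)"

lemma sum_merge:
  assumes "finite A" "finite B" "a \<in> A" "B \<inter> A \<subseteq> {a}"
  shows "sum (merge A a s) B = sum s (if a \<in> B then B \<union> A else B - A)"
proof (cases "a \<in> B")
  case True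
  have "sum (merge A a s) B = sum s A + sum (merge A a s) (B - {a})"
    using True assms(2) by (simp add: sum.remove[of B a] merge_def)
  also have "sum (merge A a s) (B - {a}) = sum s (B - A)"
    using assms True by (intro sum.cong) (auto simp: merge_def)
  also have "sum s A + sum s (B - A) = sum s (A \<union> (B - A))"
    using assms by (intro sum.union_disjoint[symmetric]) auto
  finally show ?thesis using True by (simp add: Un_commute)
next
  case False
  then show ?thesis using assms by (auto simp: merge_def intro!: sum.cong)
qed

text \<open>The correction left for the inside of A has total zero modulo 3 precisely because the
  contracted vertex received the sum of the prescriptions on A.\<close>

lemma orientable_contract:
  assumes fin: "finite E" "finite V" and A: "A \<subseteq> V" "a \<in> A"
    and contr: "orientable (insert a (V - A)) E (collapse A a \<circ> u) (collapse A a \<circ> v) (merge A a s)"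
    and inner: "\<And>s'. 3 dvd sum s' A \<Longrightarrow> orientable A (induced E u v A) u v s'"
  shows "orientable V E u v s"
proof -
  obtain w where w: "\<forall>e. w e = 1 \<or> w e = -1"
    "\<forall>x\<in>insert a (V - A). 3 dvd net E (collapse A a \<circ> u) (collapse A a \<circ> v) w x - merge A a s x"
    using contr unfolding orientable_def by blast
  have finA: "finite A" using fin A finite_subset by blast
  show ?thesis
  proof (rule orientable_glue[OF fin(1) w(1)])
    fix x assume "x \<in> V - A"
    moreover have "x \<noteq> a" using \<open>x \<in> V - A\<close> A by auto
    ultimately show "3 dvd net E u v w x - s x"
      using bspec[OF w(2), of x] net_collapse_outside[OF A(2), of x E u v w] by (simp add: merge_def)
  next
    have "3 dvd sum s A - net E (collapse A a \<circ> u) (collapse A a \<circ> v) w a"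
      using w(2) by (auto simp: merge_def dvd_diff_commute)
    then have "3 dvd (\<Sum>x\<in>A. s x - net (E - induced E u v A) u v w x)"
      by (simp add: sum_subtractf net_collapse_rep fin finA A)
    then show "orientable A (induced E u v A) u v (\<lambda>x. s x - net (E - induced E u v A) u v w x)"
      by (rule inner)
  qed
qed

text \<open>The parallel edges \<open>e\<close> and \<open>f\<close> jointly contribute 2, 0 or -2
  at x, hence every residue modulo 3, whatever the other edges do; y follows from the zero
  total.\<close>

lemma orientable_two_vertices:
  assumes fin: "finite E" and xy: "x \<noteq> y" and ef: "e \<in> E" "f \<in> E" "e \<noteq> f"
    and ends: "{u e, v e} = {x, y}" "{u f, v f} = {x, y}"
    and sub: "\<And>e. e \<in> E \<Longrightarrow> u e \<in> {x, y} \<and> v e \<in> {x, y}"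
    and s: "3 dvd s x + s y"
  shows "orientable {x, y} E u v s"
proof -
  define r where "r = net (E - {e} - {f}) u v (\<lambda>_. 1) x"
  obtain i j :: int where ij: "i = 1 \<or> i = -1" "j = 1 \<or> j = -1" "3 dvd r + i + j - s x"
  proof -
    have "3 dvd d \<or> 3 dvd d + 2 \<or> 3 dvd d - 2" for d :: int by presburger
    from this[of "r - s x"] consider "3 dvd r - s x" | "3 dvd r - s x + 2" | "3 dvd r - s x - 2"
      by blast
    then show thesis
    proof cases
      case 1 then show thesis using that[of 1 "-1"] by simp
    next
      case 2 then show thesis using that[of 1 1] by (simp add: algebra_simps)
    next
      case 3 then show thesis using that[of "-1" "-1"] by (simp add: algebra_simps)
    qed
  qed
  define w where "w g = (if g = e then (if u e = x then i else - i)
      else if g = f then (if u f = x then j else - j) else 1)" for g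
  have w: "\<forall>e. w e = 1 \<or> w e = -1" using ij by (auto simp: w_def)
  have x: "net E u v w x = r + i + j"
  proof -
    have "net (E - {e} - {f}) u v w x = r" unfolding r_def by (rule net_cong) (auto simp: w_def)
    moreover have "net E u v w x = net (E - {e} - {f}) u v w x
        + w e * (of_bool (u e = x) - of_bool (v e = x)) + w f * (of_bool (u f = x) - of_bool (v f = x))"
      using net_remove[of E e u v w x] net_remove[of "E - {e}" f u v w x] fin ef by auto
    ultimately show ?thesis using ends xy ef(3) by (auto simp: w_def doubleton_eq_iff)
  qed
  have "(\<Sum>z\<in>{x, y}. net E u v w z) = 0"
    unfolding sum_net[of "{x, y}", simplified] using sub by (intro sum.neutral) auto
  then have "net E u v w y = - net E u v w x" using xy by simp
  moreover have "3 dvd - (r + i + j) - s y" using ij(3) s by presburger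
  ultimately have "\<forall>z\<in>{x, y}. 3 dvd net E u v w z - s z" using x ij(3) by simp
  with w show ?thesis unfolding orientable_def by blast
qed

section \<open>The 6-edge-connected case\<close>

text \<open>The distance to the nearest multiple of 6. The net outflow of a vertex set is known modulo 3
  from the prescribed values and modulo 2 from its degree, hence modulo 6, and its smallest
  possible absolute value is the distance of its residue to 0.\<close>
definition rdist :: "int \<Rightarrow> int" where
  "rdist k = min (k mod 6) ((- k) mod 6)"

lemma rdist_minus: "rdist (- k) = rdist k"
  by (simp add: rdist_def min.commute)

lemma rdist_bounds: "0 \<le> rdist k" "rdist k \<le> 3"
  unfolding rdist_def by presburger+

lemma even_rdist: "even (rdist k + k)"
  unfolding rdist_def min_def by presburger

lemma rdist_cong:
  assumes "6 dvd k - l" shows "rdist k = rdist l"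
proof -
  have "k mod 6 = l mod 6" using assms by (simp add: mod_eq_dvd_iff)
  then show ?thesis by (simp add: rdist_def mod_minus_cong[of k 6 l])
qed

lemma rdist_mod: "rdist k = (if k mod 6 \<le> 3 then k mod 6 else 6 - k mod 6)"
  by (auto simp: rdist_def zmod_zminus1_eq_if)

lemma mod_6_cases: "(k :: int) mod 6 \<in> {0, 1, 2, 3, 4, 5}"
  using pos_mod_sign[of 6 k] pos_mod_bound[of 6 k] by auto

lemma rdist_mod_add: "rdist (k + c) = rdist (k mod 6 + c)"
  by (rule rdist_cong) (simp add: minus_mod_eq_mult_div)

lemma rdist_values:
  "rdist 0 = 0" "rdist 1 = 1" "rdist 2 = 2" "rdist 3 = 3" "rdist 4 = 2" "rdist 5 = 1"
  "rdist 6 = 0" "rdist 7 = 1" "rdist 8 = 2" "rdist (- 1) = 1"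
  by (simp_all add: rdist_def)

lemma rdist_Suc: "rdist (k + 1) = (if k mod 6 \<in> {0, 1, 2} then rdist k + 1 else rdist k - 1)"
  using mod_6_cases[of k] rdist_mod_add[of k 0] rdist_mod_add[of k 1] by (auto simp: rdist_values)

lemma rdist_pred: "rdist (k - 1) = (if k mod 6 \<in> {1, 2, 3} then rdist k - 1 else rdist k + 1)"
  using mod_6_cases[of k] rdist_mod_add[of k 0] rdist_mod_add[of k "-1"] by (auto simp: rdist_values)

lemma rdist_add3: "rdist (k + 3) = 3 - rdist k"
  using mod_6_cases[of k] rdist_mod_add[of k 0] rdist_mod_add[of k 3] by (auto simp: rdist_values)

lemma rdist_steps_le: "rdist (k + 1) \<le> rdist k + 1" "rdist (k - 1) \<le> rdist k + 1"
  by (simp_all add: rdist_Suc rdist_pred)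

lemma rdist_le_abs: "rdist k \<le> \<bar>k\<bar>"
  unfolding rdist_mod by presburger

text \<open>With \<open>rdist_le_abs\<close> this describes \<open>rdist\<close> as a minimum over
  representatives, from which subadditivity follows.\<close>

lemma rdist_attained: "\<exists>m. rdist k = \<bar>k - 6 * m\<bar>"
proof (cases "k mod 6 \<le> 3")
  case True
  then show ?thesis
    by (intro exI[of _ "k div 6"]) (simp add: rdist_mod minus_mult_div_eq_mod)
next
  case False
  have "k - 6 * (k div 6 + 1) = k mod 6 - 6" using mult_div_mod_eq[of 6 k] by (simp add: algebra_simps)
  then show ?thesis
    using False pos_mod_bound[of 6 k] by (intro exI[of _ "k div 6 + 1"]) (simp add: rdist_mod)
qed

lemma rdist_add_le: "rdist (k + l) \<le> rdist k + rdist l"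
proof -
  obtain m where "rdist k = \<bar>k - 6 * m\<bar>" using rdist_attained[of k] ..
  moreover obtain n where "rdist l = \<bar>l - 6 * n\<bar>" using rdist_attained[of l] ..
  moreover have "rdist (k + l) = rdist ((k - 6 * m) + (l - 6 * n))"
    by (rule rdist_cong) simp
  ultimately show ?thesis
    using rdist_le_abs[of "(k - 6 * m) + (l - 6 * n)"] by linarith
qed

section \<open>The strengthened statement with a special vertex\<close>

definition tot :: "'e set \<Rightarrow> ('e \<Rightarrow> 'v) \<Rightarrow> ('e \<Rightarrow> 'v) \<Rightarrow> ('v \<Rightarrow> int) \<Rightarrow> ('v \<Rightarrow> int) \<Rightarrow> 'v set \<Rightarrow> int" where
  "tot E u v p q A = cut_size E u v A + sum p A + sum q A"

definition tgt :: "('v \<Rightarrow> int) \<Rightarrow> ('v \<Rightarrow> int) \<Rightarrow> ('v \<Rightarrow> int) \<Rightarrow> 'v set \<Rightarrow> int" where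
  "tgt s p q A = sum s A + sum q A - sum p A"

text \<open>An edge counts twice as much as an arc at \<open>z0\<close>, since the exchange in
  \<open>not_all_out\<close> deletes an edge at the price of one more arc.\<close>

definition weight :: "'v set \<Rightarrow> 'e set \<Rightarrow> ('v \<Rightarrow> int) \<Rightarrow> ('v \<Rightarrow> int) \<Rightarrow> int" where
  "weight V E p q = 2 * int (card V) + 2 * int (card E) + sum p V + sum q V"

text \<open>The special vertex \<open>z0\<close> is not part of \<open>V\<close>: it is recorded only by the numbers \<open>p x\<close> and \<open>q x\<close> of
  its arcs towards and from \<open>x\<close>. The prescribed net outflow \<open>s\<close> refers to \<open>E\<close> alone, so that
  \<open>tgt\<close> and \<open>tot\<close> are net outflow and degree in the graph including \<open>z0\<close>.\<close>
definition feasible ::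
  "'v set \<Rightarrow> 'e set \<Rightarrow> ('e \<Rightarrow> 'v) \<Rightarrow> ('e \<Rightarrow> 'v) \<Rightarrow> ('v \<Rightarrow> int) \<Rightarrow> ('v \<Rightarrow> int) \<Rightarrow> ('v \<Rightarrow> int) \<Rightarrow> bool" where
  "feasible V E u v s p q \<longleftrightarrow>
     finite V \<and> finite E \<and> 2 \<le> card V \<and> (\<forall>e\<in>E. u e \<in> V \<and> v e \<in> V) \<and>
     (\<forall>z. 0 \<le> p z \<and> 0 \<le> q z) \<and>
     (\<forall>x\<in>V. even (cut_size E u v {x} + s x)) \<and> 6 dvd sum s V \<and>
     sum p V + sum q V \<le> 4 + rdist (sum q V - sum p V) \<and>
     (\<forall>A. A \<noteq> {} \<longrightarrow> A \<subset> V \<longrightarrow> 4 + rdist (tgt s p q A) \<le> tot E u v p q A)"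

section \<open>Minimal counterexample: contraction and slack\<close>

locale minimal_counterexample =
  fixes V :: "'v set" and E :: "'e set" and u v :: "'e \<Rightarrow> 'v" and s p q :: "'v \<Rightarrow> int"
  assumes feas: "feasible V E u v s p q"
    and not_orientable: "\<not> orientable V E u v s"
    and minimal: "\<And>(V' :: 'v set) (E' :: 'e set) u' v' s' p' q'.
      feasible V' E' u' v' s' p' q' \<Longrightarrow> weight V' E' p' q' < weight V E p q \<Longrightarrow>
      orientable V' E' u' v' s'"
begin

lemma finV: "finite V" and finE: "finite E" and card_V: "2 \<le> card V"
  and ends: "e \<in> E \<Longrightarrow> u e \<in> V \<and> v e \<in> V"
  and p_nonneg: "0 \<le> p z" and q_nonneg: "0 \<le> q z"
  and even_deg: "x \<in> V \<Longrightarrow> even (cut_size E u v {x} + s x)"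
  and sum_s: "6 dvd sum s V"
  and boundary: "sum p V + sum q V \<le> 4 + rdist (sum q V - sum p V)"
  and tot_ge: "A \<noteq> {} \<Longrightarrow> A \<subset> V \<Longrightarrow> 4 + rdist (tgt s p q A) \<le> tot E u v p q A"
  using feas unfolding feasible_def by auto

lemma finite_sub: "A \<subseteq> V \<Longrightarrow> finite A"
  using finV finite_subset by blast

lemma even_cut_s:
  assumes "A \<subseteq> V" shows "even (cut_size E u v A + sum s A)"
proof -
  have "even (\<Sum>x\<in>A. cut_size E u v {x} + s x)"
    using assms even_deg by (intro dvd_sum) auto
  then show ?thesis using even_cut_sum[OF finite_sub[OF assms], of E u v] by (simp add: sum.distrib)
qed

lemma even_tot: "A \<subseteq> V \<Longrightarrow> even (tot E u v p q A + tgt s p q A)"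
  using even_cut_s[of A] by (simp add: tot_def tgt_def)

lemma even_slack: "A \<subseteq> V \<Longrightarrow> even (tot E u v p q A - rdist (tgt s p q A))"
  using even_tot[of A] even_rdist[of "tgt s p q A"] by auto

text \<open>Degree and distance have the same parity, so slack one is impossible.\<close>

lemma tight_or_slack:
  assumes "A \<noteq> {}" "A \<subset> V"
  shows "tot E u v p q A = 4 + rdist (tgt s p q A) \<or> 6 + rdist (tgt s p q A) \<le> tot E u v p q A"
proof -
  obtain c where "tot E u v p q A - rdist (tgt s p q A) = 2 * c"
    using even_slack[of A] assms(2) evenE by blast
  then show ?thesis using tot_ge[OF assms] by arith
qed

text \<open>The sets of the contracted graph are those of the original that do not divide A, so all
  bounds are inherited. A proper leaves at least two vertices; two vertices in A make the weight
  drop.\<close>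

lemma contraction_orientable:
  assumes A: "A \<subset> V" "a \<in> A" "2 \<le> card A"
  shows "orientable (insert a (V - A)) E (collapse A a \<circ> u) (collapse A a \<circ> v) (merge A a s)"
proof (rule minimal)
  let ?V = "insert a (V - A)" and ?X = "\<lambda>B. if a \<in> B then B \<union> A else B - A"
  have fA: "finite A" using A finite_sub by auto
  have cV: "card ?V + card A = card V + 1"
    using A finV fA card_mono[OF finV, of A] by (simp add: card_Diff_subset)
  have m: "sum (merge A a f) B = sum f (?X B)" if "B \<subseteq> ?V" for f B
    using that A fA finV finite_subset[OF that] by (intro sum_merge) auto
  have V: "?X ?V = V" using A by auto
  have "card A < card V" using A finV by (simp add: psubset_card_mono)
  show "feasible ?V E (collapse A a \<circ> u) (collapse A a \<circ> v) (merge A a s) (merge A a p) (merge A a q)"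
    unfolding feasible_def
  proof (intro conjI ballI allI impI)
    show "2 \<le> card ?V" using cV \<open>card A < card V\<close> by simp
    fix e assume "e \<in> E"
    then show "(collapse A a \<circ> u) e \<in> ?V" "(collapse A a \<circ> v) e \<in> ?V"
      using ends by (auto simp: collapse_def)
  next
    fix x assume x: "x \<in> ?V"
    then have "?X {x} \<subseteq> V" using A by auto
    then have "even (cut_size E u v (?X {x}) + sum s (?X {x}))" by (rule even_cut_s)
    moreover have "merge A a s x = sum s (?X {x})" using m[of "{x}" s] x by simp
    ultimately show "even (cut_size E (collapse A a \<circ> u) (collapse A a \<circ> v) {x} + merge A a s x)"
      by (simp only: cut_collapse[OF A(2)])
  next
    fix B assume B: "B \<noteq> {}" "B \<subset> ?V"
    have "?X B \<noteq> {}" using B A by auto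
    moreover have "?X B \<subset> V" using B A by auto
    ultimately show "4 + rdist (tgt (merge A a s) (merge A a p) (merge A a q) B)
        \<le> tot E (collapse A a \<circ> u) (collapse A a \<circ> v) (merge A a p) (merge A a q) B"
      using tot_ge[of "?X B"] unfolding tgt_def tot_def cut_collapse[OF A(2)]
        m[OF psubset_imp_subset[OF B(2)]] by blast
  next
    show "sum (merge A a p) ?V + sum (merge A a q) ?V \<le> 4 + rdist (sum (merge A a q) ?V - sum (merge A a p) ?V)"
      using boundary by (simp only: m[OF subset_refl] V)
    show "6 dvd sum (merge A a s) ?V" using sum_s by (simp only: m[OF subset_refl] V)
  qed (use finV finE p_nonneg q_nonneg in \<open>auto simp: merge_def intro: sum_nonneg\<close>)
  show "weight ?V E (merge A a p) (merge A a q) < weight V E p q"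
    unfolding weight_def m[OF subset_refl] V using cV A(3) by simp
qed

text \<open>Two parallel edges realise every zero-sum prescription on their ends, so this pair could
  be contracted.\<close>

lemma no_parallel:
  assumes "e \<in> E" "f \<in> E" "e \<noteq> f" "{u e, v e} = {x, y}" "{u f, v f} = {x, y}" "x \<noteq> y"
  shows False
proof -
  have xy: "{x, y} \<subseteq> V" using ends[OF assms(1)] assms(4) by (metis insert_subset empty_subsetI)
  have two: "orientable {x, y} (induced E u v {x, y}) u v s'" if "3 dvd sum s' {x, y}" for s'
    using that assms finE by (intro orientable_two_vertices[of _ x y e f]) (auto simp: induced_def doubleton_eq_iff)
  show False
  proof (cases "V = {x, y}")
    case True
    moreover have "induced E u v V = E" using ends by (auto simp: induced_def)
    moreover have "3 dvd sum s V" using sum_s by presburger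
    ultimately show False using two[of s] not_orientable by simp
  next
    case False
    then have "orientable V E u v s"
      using xy finE finV contraction_orientable[of "{x, y}" x] two assms(6)
      by (intro orientable_contract[of E V "{x, y}" x]) auto
    then show False using not_orientable by simp
  qed
qed

text \<open>With two vertices, adding their lower bounds and comparing with the upper bound on
  \<open>z0\<close>, by subadditivity of \<open>rdist\<close>, forces two parallel edges.\<close>

lemma card_V_ge_3: "3 \<le> card V"
proof (rule ccontr)
  assume "\<not> 3 \<le> card V"
  then have "card V = 2" using card_V by simp
  then obtain x y where V: "V = {x, y}" "x \<noteq> y" by (auto simp: card_2_iff)
  have "V - {x} = {y}" using V by auto
  then have "cut_size E u v {y} = cut_size E u v {x}" using cut_compl[of E u V v "{x}"] ends by simp
  moreover have "4 + rdist (tgt s p q {x}) \<le> tot E u v p q {x}" "4 + rdist (tgt s p q {y}) \<le> tot E u v p q {y}"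
    using V by (auto intro!: tot_ge)
  moreover have "rdist (sum q V - sum p V) = rdist (tgt s p q {x} + tgt s p q {y})"
    using sum_s V by (intro rdist_cong) (simp add: tgt_def algebra_simps dvd_diff_commute)
  ultimately have "2 \<le> cut_size E u v {x}"
    using boundary V rdist_add_le[of "tgt s p q {x}" "tgt s p q {y}"] by (simp add: tot_def)
  then obtain e f where ef: "e \<in> E" "f \<in> E" "e \<noteq> f" "(u e \<in> {x}) \<noteq> (v e \<in> {x})" "(u f \<in> {x}) \<noteq> (v f \<in> {x})"
    using cut_ge_2E[OF finE] by blast
  then have "{u e, v e} = {x, y}" "{u f, v f} = {x, y}"
    using ends[OF ef(1)] ends[OF ef(2)] V by auto
  then show False using no_parallel[of e f x y] ef V by simp
qed

text \<open>A tight set \<open>A\<close> allows contracting \<open>A\<close> first and then taking the contracted complement of \<open>A\<close>,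
  with its arcs just oriented, for the new vertex \<open>z0\<close>.\<close>
lemma slack_ge_2:
  assumes A: "A \<subset> V" "2 \<le> card A"
  shows "6 + rdist (tgt s p q A) \<le> tot E u v p q A"
proof (rule ccontr)
  assume neg: "\<not> ?thesis"
  obtain a where a: "a \<in> A" using A by fastforce
  then have tight: "tot E u v p q A = 4 + rdist (tgt s p q A)"
    using neg tight_or_slack[of A] A(1) by blast
  have fA: "finite A" using A finite_sub by auto
  obtain w where w: "\<forall>e. w e = 1 \<or> w e = -1"
    "\<forall>x\<in>insert a (V - A). 3 dvd net E (collapse A a \<circ> u) (collapse A a \<circ> v) w x - merge A a s x"
    using contraction_orientable[OF A(1) a A(2)] unfolding orientable_def by blast
  let ?I = "induced E u v A"
  let ?n = "net (E - ?I) u v w"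
  \<comment> \<open>The directions of \<open>w\<close> on edges leaving A become arcs at
    \<open>z0\<close>: \<open>i\<close> counts those entering x, \<open>o'\<close> those leaving
    x.\<close>
  define i where "i x = (\<Sum>e\<in>E - ?I. of_bool (w e = 1 \<and> v e = x) + of_bool (w e = -1 \<and> u e = x) :: int)" for x
  define o' where "o' x = (\<Sum>e\<in>E - ?I. of_bool (w e = 1 \<and> u e = x) + of_bool (w e = -1 \<and> v e = x) :: int)" for x
  have nonneg: "0 \<le> i x" "0 \<le> o' x" for x unfolding i_def o'_def by (auto intro!: sum_nonneg)
  have net: "o' x - i x = ?n x" for x
    unfolding i_def o'_def net_def sum_subtractf[symmetric] using w(1) by (intro sum.cong) fastforce+
  have io: "sum i B + sum o' B = (\<Sum>e\<in>E - ?I. of_bool (u e \<in> B) + of_bool (v e \<in> B))" if "finite B" for B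
  proof -
    have "i x + o' x = (\<Sum>e\<in>E - ?I. of_bool (u e = x) + of_bool (v e = x))" for x
      unfolding i_def o'_def sum.distrib[symmetric] using w(1) by (intro sum.cong) fastforce+
    then have "sum i B + sum o' B = (\<Sum>x\<in>B. \<Sum>e\<in>E - ?I. of_bool (u e = x) + of_bool (v e = x))"
      by (simp add: sum.distrib[symmetric])
    also have "\<dots> = (\<Sum>e\<in>E - ?I. of_bool (u e \<in> B) + of_bool (v e \<in> B))"
      by (subst sum.swap) (simp del: sum_of_bool_eq add: sum.distrib sum_of_bool_singleton that)
    finally show ?thesis .
  qed
  have cut: "cut_size E u v B = cut_size ?I u v B + sum i B + sum o' B" if "B \<subseteq> A" for B
  proof -
    have "cut_size E u v B = cut_size (E - ?I) u v B + cut_size ?I u v B"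
      unfolding cut_size_def using finE by (intro sum.subset_diff) (auto simp: induced_def)
    moreover have "cut_size (E - ?I) u v B = (\<Sum>e\<in>E - ?I. of_bool (u e \<in> B) + of_bool (v e \<in> B))"
      unfolding cut_size_def using that by (intro sum.cong) (auto simp: induced_def)
    ultimately show ?thesis using io[of B] fA finite_subset[OF that] by simp
  qed
  define s' where "s' x = s x - ?n x" for x
  define p' where "p' x = p x + i x" for x
  define q' where "q' x = q x + o' x" for x
  have cutA: "cut_size ?I u v A = 0"
    unfolding cut_size_def by (intro sum.neutral) (auto simp: induced_def)
  have even_x: "even (cut_size ?I u v {x} + s' x)" if "x \<in> A" for x
  proof -
    have "even (cut_size E u v {x} + s x)" using even_deg that A by auto
    then show ?thesis using cut[of "{x}"] that net[of x] unfolding s'_def by simp presburger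
  qed
  have s3: "3 dvd sum s' A"
  proof -
    have "3 dvd sum s A - net E (collapse A a \<circ> u) (collapse A a \<circ> v) w a"
      using w(2) by (auto simp: merge_def dvd_diff_commute)
    then show ?thesis by (simp add: s'_def sum_subtractf net_collapse_rep finE fA a)
  qed
  have "even (\<Sum>x\<in>A. cut_size ?I u v {x} + s' x)" by (intro dvd_sum even_x)
  then have "even (sum s' A)" using even_cut_sum[OF fA, of ?I u v] cutA by (simp add: sum.distrib)
  then have s6: "6 dvd sum s' A" using s3 by presburger
  have tgt: "tgt s' p' q' B = tgt s p q B" for B
    using net by (simp add: tgt_def s'_def p'_def q'_def sum.distrib sum_subtractf algebra_simps flip: net)
  have tot: "tot ?I u v p' q' B = tot E u v p q B" if "B \<subseteq> A" for B
    using cut[OF that] by (simp add: tot_def p'_def q'_def sum.distrib)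
  have "orientable A ?I u v s'"
  proof (rule minimal)
    show "feasible A ?I u v s' p' q'"
      unfolding feasible_def
    proof (intro conjI allI ballI impI)
      \<comment> \<open>Inside A no edge leaves, so the whole degree of A now consists of arcs at
        \<open>z0\<close>, and tightness of A is the required upper bound.\<close>
      have "rdist (sum q' A - sum p' A) = rdist (tgt s' p' q' A)"
        using s6 by (intro rdist_cong) (simp add: tgt_def dvd_diff_commute)
      then show "sum p' A + sum q' A \<le> 4 + rdist (sum q' A - sum p' A)"
        using tight tot[of A] cutA tgt[of A] by (simp add: tot_def)
    next
      fix B assume "B \<noteq> {}" "B \<subset> A"
      then show "4 + rdist (tgt s' p' q' B) \<le> tot ?I u v p' q' B"
        using tot_ge[of B] tot[of B] tgt[of B] A by auto
    qed (use fA A finE s6 even_x p_nonneg q_nonneg nonneg in \<open>auto simp: induced_def p'_def q'_def\<close>)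
    have "sum i A + sum o' A \<le> (\<Sum>e\<in>E - ?I. 2)"
      unfolding io[OF fA] by (intro sum_mono) auto
    moreover have "card E = card ?I + card (E - ?I)"
      using finE by (subst card_Un_disjoint[symmetric]) (auto simp: induced_def intro!: arg_cong[where f=card])
    moreover have "sum p A \<le> sum p V" "sum q A \<le> sum q V"
      using A finV p_nonneg q_nonneg by (auto intro!: sum_mono2)
    moreover have "card A < card V" using A finV by (simp add: psubset_card_mono)
    ultimately show "weight A ?I p' q' < weight V E p q"
      by (simp add: weight_def p'_def q'_def sum.distrib)
  qed
  moreover have "3 dvd net E u v w x - s x" if "x \<in> V - A" for x
  proof -
    have "x \<noteq> a" using that a by auto
    then show ?thesis
      using bspec[OF w(2), of x] that net_collapse_outside[OF a, of x E u v w] by (simp add: merge_def)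
  qed
  ultimately have "orientable V E u v s"
    using orientable_glue[OF finE w(1), of V A u v s] unfolding s'_def by blast
  then show False using not_orientable by simp
qed

lemma no_loop:
  assumes "e \<in> E" shows "u e \<noteq> v e"
proof
  assume loop: "u e = v e"
  have cut: "cut_size (E - {e}) u v A = cut_size E u v A" for A
    using cut_remove[OF finE assms, of u v A] loop by simp
  have "weight V (E - {e}) p q < weight V E p q"
    using assms finE card_gt_0_iff[of E] by (auto simp: weight_def)
  moreover have "feasible V (E - {e}) u v s p q"
    using feas unfolding feasible_def tot_def cut by auto
  ultimately have "orientable V (E - {e}) u v s" by (rule minimal[rotated])
  moreover have "add_at (v e) 1 (add_at (v e) (-1) s) = s" by (auto simp: add_at_def)
  ultimately show False
    using orientable_delete[OF finE assms, where x = "v e" and y = "v e" and V = V and s = s and u = u and v = v] loop not_orientable by simp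
qed

lemma edge_at:
  assumes "e \<in> E" "(u e \<in> {x}) \<noteq> (v e \<in> {x})"
  obtains y where "{u e, v e} = {x, y}" "y \<noteq> x" "y \<in> V"
  using assms ends[of e] by (cases "u e = x") auto

lemma edge_ends:
  assumes "e \<in> E" "{u e, v e} = {x, y}"
  shows "x \<in> V" "y \<in> V" "x \<noteq> y"
  using assms ends[of e] no_loop[of e] by (auto simp: doubleton_eq_iff)

lemma singleton_psubset: "x \<in> V \<Longrightarrow> {x} \<subset> V"
  using card_V by auto

text \<open>The 7 is \<open>4 + 3\<close>, the largest degree that \<open>z0\<close> can
  have.\<close>

lemma tot_compl_le: "A \<subseteq> V \<Longrightarrow> tot E u v p q A + tot E u v p q (V - A) \<le> 2 * cut_size E u v A + 7"
  using boundary rdist_bounds(2)[of "sum q V - sum p V"] cut_compl[of E u V v A] ends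
    sum.subset_diff[of A V p] sum.subset_diff[of A V q] finV
  by (simp add: tot_def)

text \<open>Both sides have degree at least 4, together 8, and arcs at \<open>z0\<close> account for
  at most 7.\<close>

lemma connected:
  assumes "A \<noteq> {}" "A \<subset> V"
  obtains e where "e \<in> E" "(u e \<in> A) \<noteq> (v e \<in> A)"
proof -
  have "V - A \<noteq> {}" "V - A \<subset> V" using assms by auto
  then have "4 \<le> tot E u v p q A" "4 \<le> tot E u v p q (V - A)"
    using tot_ge[of A] tot_ge[of "V - A"] assms rdist_bounds(1)
    by (smt (verit, best))+
  then have "1 \<le> cut_size E u v A" using tot_compl_le[of A] assms by auto
  then show thesis using that by (auto simp: cut_pos_iff[OF finE])
qed

section \<open>Vertices that tolerate the loss of an edge\<close>

text \<open>\<open>out_ok x\<close> says that the condition at the vertex \<open>x\<close> survives deleting an edge directed out of \<open>x\<close>.\<close>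
definition out_ok :: "'v \<Rightarrow> bool" where
  "out_ok x \<longleftrightarrow> 5 + rdist (tgt s p q {x} - 1) \<le> tot E u v p q {x}"

definition in_ok :: "'v \<Rightarrow> bool" where
  "in_ok x \<longleftrightarrow> 5 + rdist (tgt s p q {x} + 1) \<le> tot E u v p q {x}"

lemma singleton_or_large:
  assumes "A \<noteq> {}" "A \<subset> V"
  obtains x where "A = {x}" | "2 \<le> card A"
proof -
  have "card A \<noteq> 0" using assms finite_sub[of A] by auto
  then consider "card A = 1" | "2 \<le> card A" by linarith
  then show thesis using that by cases (auto simp: card_1_singleton_iff)
qed

text \<open>Deletion costs a set at most one in degree and one in distance. Sets with two or more
  vertices pay with their slack, so only the two ends could object.\<close>

lemma edge_blocked:
  assumes e: "e \<in> E" "{u e, v e} = {x, y}" and ok: "out_ok x" "in_ok y"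
  shows False
proof -
  note xy = edge_ends[OF e]
  let ?s = "add_at y 1 (add_at x (-1) s)"
  have cut: "cut_size (E - {e}) u v A = cut_size E u v A - of_bool ((x \<in> A) \<noteq> (y \<in> A))" for A
    using cut_remove[OF finE e(1), of u v A] e(2) by (auto simp: doubleton_eq_iff)
  have s: "sum ?s A = sum s A - of_bool (x \<in> A) + of_bool (y \<in> A)" if "finite A" for A
    using that by (simp add: sum_add_at)
  have "orientable V (E - {e}) u v ?s"
  proof (rule minimal)
    show "feasible V (E - {e}) u v ?s p q"
      unfolding feasible_def
    proof (intro conjI ballI allI impI)
      fix z assume "z \<in> V"
      then show "even (cut_size (E - {e}) u v {z} + ?s z)"
        using even_deg[of z] xy by (auto simp: cut add_at_def)
    next
      show "6 dvd sum ?s V" using sum_s xy by (simp add: s finV)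
    next
      fix A assume A: "A \<noteq> {}" "A \<subset> V"
      have fA: "finite A" using A finite_sub by auto
      have tgt: "tgt ?s p q A = tgt s p q A - of_bool (x \<in> A) + of_bool (y \<in> A)"
        by (simp add: tgt_def s fA)
      have tot: "tot (E - {e}) u v p q A = tot E u v p q A - of_bool ((x \<in> A) \<noteq> (y \<in> A))"
        by (simp add: tot_def cut)
      from A show "4 + rdist (tgt ?s p q A) \<le> tot (E - {e}) u v p q A"
      proof (cases rule: singleton_or_large)
        case (1 z)
        then show ?thesis
          using ok xy tot_ge[of "{z}"] A unfolding tgt tot out_ok_def in_ok_def by auto
      next
        case 2
        then show ?thesis
          using slack_ge_2[OF A(2)] rdist_steps_le[of "tgt s p q A"] unfolding tgt tot by auto
      qed
    qed (use finV finE card_V ends p_nonneg q_nonneg boundary in auto)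
    show "weight V (E - {e}) p q < weight V E p q"
      using e(1) finE card_gt_0_iff[of E] by (auto simp: weight_def)
  qed
  then show False using orientable_delete[of E e u v x y] finE e not_orientable by blast
qed

lemma rdist_eq_of_dvd_add: "6 dvd k + l \<Longrightarrow> rdist k = rdist l"
  using rdist_cong[of k "- l"] by (simp add: rdist_minus)

text \<open>With slack two, x would tolerate either direction, so x is tight. Then neither
  neighbouring residue is closer to 0 modulo 6, which leaves only residue 0, and degree
  four.\<close>

lemma blocked_vertex:
  assumes x: "x \<in> V" and no: "\<not> out_ok x" "\<not> in_ok x"
  shows "tot E u v p q {x} = 4" "6 dvd tgt s p q {x}" "p x + q x \<le> 1"
proof -
  let ?t = "tgt s p q {x}"
  have tight: "tot E u v p q {x} = 4 + rdist ?t"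
    using tight_or_slack[of "{x}"] singleton_psubset[OF x] no rdist_steps_le[of ?t]
    unfolding out_ok_def in_ok_def by auto
  then have "rdist (?t - 1) \<ge> rdist ?t" "rdist (?t + 1) \<ge> rdist ?t"
    using no unfolding out_ok_def in_ok_def by auto
  then show t: "6 dvd ?t"
    using mod_6_cases[of ?t] unfolding rdist_Suc rdist_pred by (auto simp: dvd_eq_mod_eq_0 split: if_splits)
  then show four: "tot E u v p q {x} = 4" using tight by (auto simp: rdist_def)
  have V: "sum f V = sum f (V - {x}) + f x" for f :: "'v \<Rightarrow> int"
    using x finV by (simp add: sum.remove)
  \<comment> \<open>With c arcs at x, S arcs at \<open>z0\<close> and distance r, the slack of the
    complement reads \<open>(4 - c) + (S - c) \<ge> 6 + r\<close>, while
    \<open>S \<le> 4 + r\<close>; hence \<open>c \<le> 1\<close>.\<close>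
  have "6 + rdist (tgt s p q (V - {x})) \<le> tot E u v p q (V - {x})"
    using x card_V_ge_3 finV by (intro slack_ge_2) (auto simp: card_Diff_singleton)
  moreover have "rdist (sum q V - sum p V) = rdist (tgt s p q (V - {x}))"
  proof (rule rdist_cong)
    have "sum q V - sum p V - tgt s p q (V - {x}) = tgt s p q {x} - sum s V"
      by (simp add: tgt_def V)
    then show "6 dvd sum q V - sum p V - tgt s p q (V - {x})" using t sum_s by simp
  qed
  moreover have "cut_size E u v (V - {x}) = cut_size E u v {x}" using ends by (intro cut_compl) auto
  ultimately show "p x + q x \<le> 1"
    using boundary four by (simp add: tot_def V)
qed

lemma edges_at_distinct_ends:
  assumes "e \<in> E" "f \<in> E" "e \<noteq> f" "{u e, v e} = {x, a}" "{u f, v f} = {x, b}"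
  shows "a \<noteq> b"
  using no_parallel[of e f x a] assms edge_ends[of e x a] by auto

lemma ends_avoid:
  assumes "e \<in> E" "\<not> (u e \<in> {x}) \<noteq> (v e \<in> {x})"
  shows "u e \<in> V - {x} \<and> v e \<in> V - {x}"
  using assms ends[of e] no_loop[of e] by auto

lemma sum_delete_vertex: "x \<in> V \<Longrightarrow> sum (f :: 'v \<Rightarrow> int) (V - {x}) = sum f V - f x"
  using finV by (simp add: sum.remove)

text \<open>A vertex of total degree 4 and residue 0 has two arcs in and two arcs out, so it can be
  removed by splitting off its edges in pairs; an arc at \<open>z0\<close> is moved to the other end of its partner.\<close>
lemma blocked_arc_False:
  assumes x: "x \<in> V" and no: "\<not> out_ok x" "\<not> in_ok x" and c: "p x + q x = 1"
  shows False
proof -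
  let ?S = "{e \<in> E. (u e \<in> {x}) \<noteq> (v e \<in> {x})}"
  note bl = blocked_vertex[OF x no]
  have "card ?S = 3" using bl(1) c cut_eq_card[OF finE, of u v "{x}"] by (simp add: tot_def)
  moreover obtain es where es: "set es = ?S" "distinct es"
    using finite_distinct_list[of ?S] finE by auto
  ultimately have "length es = 3" using distinct_card[OF es(2)] by simp
  then obtain e f g where efg: "es = [e, f, g]"
    by (auto simp: length_Suc_conv numeral_eq_Suc)
  then have S: "?S = {e, f, g}" and ne: "e \<noteq> f" "e \<noteq> g" "f \<noteq> g" using es by auto
  then have inE: "e \<in> E" "f \<in> E" "g \<in> E" and
    cr: "(u e \<in> {x}) \<noteq> (v e \<in> {x})" "(u f \<in> {x}) \<noteq> (v f \<in> {x})" "(u g \<in> {x}) \<noteq> (v g \<in> {x})"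
    by blast+
  obtain a where a: "{u e, v e} = {x, a}" "a \<noteq> x" "a \<in> V" using edge_at[OF inE(1) cr(1)] .
  obtain b where b: "{u f, v f} = {x, b}" "b \<noteq> x" "b \<in> V" using edge_at[OF inE(2) cr(2)] .
  obtain y where y: "{u g, v g} = {x, y}" "y \<noteq> x" "y \<in> V" using edge_at[OF inE(3) cr(3)] .
  have ab: "a \<noteq> b" using edges_at_distinct_ends[of e f x a b] inE ne a b by simp
  let ?u = "u(e := a)" and ?v = "v(e := b)" and ?E1 = "E - {f}" and ?E2 = "E - {f} - {g}"
  \<comment> \<open>For d = 1 the arc points towards x and \<open>g\<close> is directed from x to y,
    so the path from \<open>z0\<close> over x to y becomes an arc from \<open>z0\<close> to y. For d
    = -1 everything is reversed.\<close>
  define d where "d = p x - q x"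
  have d: "d = 1 \<or> d = -1" using c p_nonneg[of x] q_nonneg[of x] unfolding d_def by presburger
  let ?s = "add_at y d (add_at x (- d) s)"
  let ?p = "add_at y (p x) p" and ?q = "add_at y (q x) q"
  have yg: "{?u g, ?v g} = {x, y}" using y ne by simp
  have end2: "?u h \<in> V - {x} \<and> ?v h \<in> V - {x}" if "h \<in> ?E2" for h
  proof (cases "h = e")
    case False
    then show ?thesis using that S ends_avoid[of h x] by auto
  qed (use a b in simp)
  have cut: "cut_size ?E2 ?u ?v A = cut_size E u v A - 2 * of_bool (a \<in> A \<and> b \<in> A) - of_bool (y \<in> A)"
    if "x \<notin> A" for A
  proof -
    have "cut_size ?E2 ?u ?v A = cut_size ?E1 ?u ?v A - of_bool ((?u g \<in> A) \<noteq> (?v g \<in> A))"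
      using finE inE ne by (intro cut_remove) auto
    also have "(?u g \<in> A) \<noteq> (?v g \<in> A) \<longleftrightarrow> y \<in> A" using yg that by (auto simp: doubleton_eq_iff)
    also have "cut_size ?E1 ?u ?v A = cut_size E u v A - 2 * of_bool (a \<in> A \<and> b \<in> A)"
      using cut_split[OF finE inE(1,2) ne(1) a(1) b(1), of A] that by auto
    finally show ?thesis .
  qed
  have "orientable (V - {x}) ?E2 ?u ?v ?s"
  proof (rule minimal)
    show "feasible (V - {x}) ?E2 ?u ?v ?s ?p ?q"
      unfolding feasible_def
    proof (intro conjI ballI allI impI)
      show "2 \<le> card (V - {x})" using card_V_ge_3 finV x by simp
      fix z assume "z \<in> V - {x}"
      then show "even (cut_size ?E2 ?u ?v {z} + ?s z)"
        using even_deg[of z] cut[of "{z}"] d by (auto simp: add_at_def)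
    next
      have "sum ?s (V - {x}) = sum s V - tgt s p q {x}"
        using x y finV by (simp add: sum_add_at sum_delete_vertex add_at_def[of _ _ _ x] d_def tgt_def)
      then show "6 dvd sum ?s (V - {x})" using sum_s bl(2) by simp
    next
      show "sum ?p (V - {x}) + sum ?q (V - {x}) \<le> 4 + rdist (sum ?q (V - {x}) - sum ?p (V - {x}))"
        using x y finV boundary by (simp add: sum_add_at sum_delete_vertex add_at_def[of _ _ _ x])
    next
      fix A assume A: "A \<noteq> {}" "A \<subset> V - {x}"
      then have fA: "finite A" "x \<notin> A" "A \<subset> V" using finite_sub by auto
      have tgt: "tgt ?s ?p ?q A = tgt s p q A"
        by (simp add: tgt_def sum_add_at fA d_def)
      have tot: "tot ?E2 ?u ?v ?p ?q A = tot E u v p q A - 2 * of_bool (a \<in> A \<and> b \<in> A)"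
        using c by (simp add: tot_def sum_add_at fA cut)
      \<comment> \<open>Splitting off costs two only for sets containing both a and b; as a and b
        differ, these are not singletons and have slack two.\<close>
      from A(1) fA(3) show "4 + rdist (tgt ?s ?p ?q A) \<le> tot ?E2 ?u ?v ?p ?q A"
      proof (cases rule: singleton_or_large)
        case (1 z)
        then show ?thesis using tot_ge[OF A(1) fA(3)] ab unfolding tgt tot by auto
      next
        case 2
        then show ?thesis using slack_ge_2[OF fA(3)] unfolding tgt tot by auto
      qed
    qed (use finV finE end2 p_nonneg q_nonneg sum_s in \<open>auto simp: add_at_def\<close>)
    have "card ?E2 \<le> card E" using finE by (intro card_mono) auto
    moreover have "card (V - {x}) < card V" using finV x by (intro psubset_card_mono) auto
    ultimately show "weight (V - {x}) ?E2 ?p ?q < weight V E p q"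
      using x y finV by (simp add: weight_def sum_add_at sum_delete_vertex add_at_def[of _ _ _ x])
  qed
  then have "orientable V ?E2 ?u ?v ?s"
  proof (rule orientable_isolated)
    have "?s x = tgt s p q {x}" using y by (simp add: add_at_def d_def tgt_def)
    then show "3 dvd ?s x" using bl(2) by presburger
  qed (use end2 in auto)
  then have "orientable V ?E1 ?u ?v s"
    using d
  proof (elim disjE)
    assume "orientable V ?E2 ?u ?v ?s" "d = 1"
    then show ?thesis using finE inE ne yg by (intro orientable_delete[of ?E1 g ?u ?v x y]) auto
  next
    assume "orientable V ?E2 ?u ?v ?s" "d = -1"
    moreover have "add_at y (- 1) (add_at x 1 s) = add_at x 1 (add_at y (- 1) s)"
      by (auto simp: add_at_def)
    ultimately show ?thesis
      using finE inE ne yg by (intro orientable_delete[of ?E1 g ?u ?v y x]) auto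
  qed
  then have "orientable V E u v s" by (rule orientable_split[OF finE inE(1,2) ne(1) a(1) b(1)])
  then show False using not_orientable by simp
qed

text \<open>The four edges at x are split off in two pairs. The slack pays for one pair; only a set
  containing all four neighbours loses more.\<close>

lemma blocked_no_arc_False:
  assumes x: "x \<in> V" and no: "\<not> out_ok x" "\<not> in_ok x" and c: "p x = 0" "q x = 0"
  shows False
proof -
  let ?S = "{e \<in> E. (u e \<in> {x}) \<noteq> (v e \<in> {x})}"
  note bl = blocked_vertex[OF x no]
  have sx: "6 dvd s x" using bl(2) c by (simp add: tgt_def)
  have "card ?S = 4" using bl(1) c cut_eq_card[OF finE, of u v "{x}"] by (simp add: tot_def)
  moreover obtain es where es: "set es = ?S" "distinct es"
    using finite_distinct_list[of ?S] finE by auto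
  ultimately have "length es = 4" using distinct_card[OF es(2)] by simp
  then obtain e f g h where efg: "es = [e, f, g, h]"
    by (auto simp: length_Suc_conv numeral_eq_Suc)
  then have S: "?S = {e, f, g, h}" and ne: "e \<noteq> f" "e \<noteq> g" "e \<noteq> h" "f \<noteq> g" "f \<noteq> h" "g \<noteq> h"
    using es by auto
  then have inE: "e \<in> E" "f \<in> E" "g \<in> E" "h \<in> E" and
    cr: "(u e \<in> {x}) \<noteq> (v e \<in> {x})" "(u f \<in> {x}) \<noteq> (v f \<in> {x})"
      "(u g \<in> {x}) \<noteq> (v g \<in> {x})" "(u h \<in> {x}) \<noteq> (v h \<in> {x})"
    by blast+
  obtain a where a: "{u e, v e} = {x, a}" "a \<noteq> x" "a \<in> V" using edge_at[OF inE(1) cr(1)] .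
  obtain b where b: "{u f, v f} = {x, b}" "b \<noteq> x" "b \<in> V" using edge_at[OF inE(2) cr(2)] .
  obtain a' where a': "{u g, v g} = {x, a'}" "a' \<noteq> x" "a' \<in> V" using edge_at[OF inE(3) cr(3)] .
  obtain b' where b': "{u h, v h} = {x, b'}" "b' \<noteq> x" "b' \<in> V" using edge_at[OF inE(4) cr(4)] .
  have ab: "a \<noteq> b" "a' \<noteq> b'"
    using edges_at_distinct_ends[of e f x a b] edges_at_distinct_ends[of g h x a' b'] inE ne a b a' b' by simp_all
  let ?u1 = "u(e := a)" and ?v1 = "v(e := b)" and ?E1 = "E - {f}"
  let ?u = "u(e := a, g := a')" and ?v = "v(e := b, g := b')" and ?E2 = "E - {f} - {h}"
  have gh: "{?u1 g, ?v1 g} = {x, a'}" "{?u1 h, ?v1 h} = {x, b'}" using a' b' ne by simp_all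
  have E1: "finite ?E1" "g \<in> ?E1" "h \<in> ?E1" using finE inE ne by auto
  have end2: "?u k \<in> V - {x} \<and> ?v k \<in> V - {x}" if "k \<in> ?E2" for k
  proof (cases "k = e \<or> k = g")
    case False
    then show ?thesis using that S ends_avoid[of k x] by auto
  qed (use a b a' b' in auto)
  have cut: "cut_size ?E2 ?u ?v A = cut_size E u v A
      - of_bool ((x \<in> A) \<noteq> (a \<in> A)) - of_bool ((x \<in> A) \<noteq> (b \<in> A)) + of_bool ((a \<in> A) \<noteq> (b \<in> A))
      - of_bool ((x \<in> A) \<noteq> (a' \<in> A)) - of_bool ((x \<in> A) \<noteq> (b' \<in> A)) + of_bool ((a' \<in> A) \<noteq> (b' \<in> A))" for A
    unfolding cut_split[OF E1 ne(6) gh] cut_split[OF finE inE(1,2) ne(1) a(1) b(1)] ..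
  have "orientable (V - {x}) ?E2 ?u ?v s"
  proof (rule minimal)
    show "feasible (V - {x}) ?E2 ?u ?v s p q"
      unfolding feasible_def
    proof (intro conjI ballI allI impI)
      show "2 \<le> card (V - {x})" using card_V_ge_3 finV x by simp
      fix z assume "z \<in> V - {x}"
      then show "even (cut_size ?E2 ?u ?v {z} + s z)"
        using even_deg[of z] cut[of "{z}"] by auto
    next
      show "6 dvd sum s (V - {x})" using sum_s sx x by (simp add: sum_delete_vertex)
    next
      show "sum p (V - {x}) + sum q (V - {x}) \<le> 4 + rdist (sum q (V - {x}) - sum p (V - {x}))"
        using x c boundary by (simp add: sum_delete_vertex)
    next
      fix A assume A: "A \<noteq> {}" "A \<subset> V - {x}"
      then have fA: "finite A" "x \<notin> A" "A \<subset> V" using finite_sub by auto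
      have tot: "tot ?E2 ?u ?v p q A = tot E u v p q A
          - 2 * of_bool (a \<in> A \<and> b \<in> A) - 2 * of_bool (a' \<in> A \<and> b' \<in> A)"
        using fA(2) by (auto simp: tot_def cut)
      from A(1) fA(3) show "4 + rdist (tgt s p q A) \<le> tot ?E2 ?u ?v p q A"
      proof (cases rule: singleton_or_large)
        case (1 z)
        then show ?thesis using tot_ge[OF A(1) fA(3)] ab unfolding tot by auto
      next
        case 2
        show ?thesis
        proof (cases "{a, b, a', b'} \<subseteq> A")
          case False
          then show ?thesis using slack_ge_2[OF fA(3) 2] unfolding tot by auto
        next
          case True
          \<comment> \<open>Such a set has, after splitting, the degree that
            \<open>insert x A\<close> had before, and x adds residue 0, so the bound for
            \<open>insert x A\<close> is the one to use.\<close>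
          have "cut_size ?E2 ?u ?v A = cut_size ?E2 ?u ?v (insert x A)"
            unfolding cut_size_def using end2 by (intro sum.cong) auto
          also have "\<dots> = cut_size E u v (insert x A)" using True by (auto simp: cut)
          finally have "tot ?E2 ?u ?v p q A = tot E u v p q (insert x A)"
            using fA c by (simp add: tot_def)
          moreover have "insert x A \<subset> V" using A x by auto
          moreover have "rdist (tgt s p q (insert x A)) = rdist (tgt s p q A)"
            using fA c sx by (intro rdist_cong) (simp add: tgt_def)
          ultimately show ?thesis using tot_ge[of "insert x A"] by simp
        qed
      qed
    qed (use finV finE end2 p_nonneg q_nonneg sum_s in auto)
    have "card ?E2 \<le> card E" using finE by (intro card_mono) auto
    moreover have "card (V - {x}) < card V" using finV x by (intro psubset_card_mono) auto
    ultimately show "weight (V - {x}) ?E2 p q < weight V E p q"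
      using x c by (simp add: weight_def sum_delete_vertex)
  qed
  then have "orientable V ?E2 ?u ?v s"
  proof (rule orientable_isolated)
    show "3 dvd s x" using sx by presburger
  qed (use end2 in blast)
  then have "orientable V ?E1 ?u1 ?v1 s" by (rule orientable_split[OF E1 ne(6) gh])
  then have "orientable V E u v s" by (rule orientable_split[OF finE inE(1,2) ne(1) a(1) b(1)])
  then show False using not_orientable by simp
qed

lemma not_blocked: "x \<in> V \<Longrightarrow> out_ok x \<or> in_ok x"
  using blocked_vertex(3)[of x] blocked_arc_False[of x] blocked_no_arc_False[of x]
    p_nonneg[of x] q_nonneg[of x] by fastforce

text \<open>By \<open>not_blocked\<close> such a vertex tolerates an edge going out, so a step down
  approaches 0 modulo 6 while a step up does not. Residue 3 fails because both steps approach
  0.\<close>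

lemma tight_values:
  assumes "x \<in> V" "\<not> in_ok x"
  shows "tot E u v p q {x} = 4 + rdist (tgt s p q {x})" "tgt s p q {x} mod 6 \<in> {1, 2}"
proof -
  let ?t = "tgt s p q {x}"
  show t: "tot E u v p q {x} = 4 + rdist ?t"
    using tight_or_slack[of "{x}"] singleton_psubset assms rdist_steps_le[of ?t]
    unfolding in_ok_def by auto
  have "rdist ?t \<le> rdist (?t + 1)" "rdist (?t - 1) < rdist ?t"
    using assms not_blocked[of x] t unfolding in_ok_def out_ok_def by auto
  then show "?t mod 6 \<in> {1, 2}" unfolding rdist_Suc rdist_pred by (auto split: if_splits)
qed

text \<open>Dropping an arc from x to \<open>z0\<close> costs x the same as deleting an outgoing
  edge, and the prescription on E stays as it is.\<close>

lemma out_arc_removable: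
  assumes x: "x \<in> V" "out_ok x" shows "q x = 0"
proof (rule ccontr)
  assume "q x \<noteq> 0"
  then have q: "1 \<le> q x" using q_nonneg[of x] by simp
  let ?q = "add_at x (-1) q"
  have "orientable V E u v s"
  proof (rule minimal)
    show "feasible V E u v s p ?q"
      unfolding feasible_def
    proof (intro conjI ballI allI impI)
      show "sum p V + sum ?q V \<le> 4 + rdist (sum ?q V - sum p V)"
        using boundary x finV rdist_steps_le(1)[of "sum q V - sum p V - 1"] by (simp add: sum_add_at algebra_simps)
      fix A assume A: "A \<noteq> {}" "A \<subset> V"
      have fA: "finite A" using A finite_sub by auto
      have tgt: "tgt s p ?q A = tgt s p q A - of_bool (x \<in> A)" by (simp add: tgt_def sum_add_at fA)
      have tot: "tot E u v p ?q A = tot E u v p q A - of_bool (x \<in> A)" by (simp add: tot_def sum_add_at fA)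
      from A show "4 + rdist (tgt s p ?q A) \<le> tot E u v p ?q A"
      proof (cases rule: singleton_or_large)
        case (1 z)
        then show ?thesis using x tot_ge[OF A] unfolding tgt tot out_ok_def by auto
      next
        case 2
        then show ?thesis using slack_ge_2[OF A(2)] rdist_steps_le[of "tgt s p q A"] unfolding tgt tot by auto
      qed
    qed (use finV finE card_V ends p_nonneg q_nonneg q even_deg sum_s in \<open>auto simp: add_at_def\<close>)
    show "weight V E p ?q < weight V E p q" using x finV by (simp add: weight_def sum_add_at)
  qed
  then show False using not_orientable by simp
qed

text \<open>Modulo 3, an arc from \<open>z0\<close> to \<open>x\<close> is worth two arcs from \<open>x\<close> to \<open>z0\<close>. This exchange gives \<open>x\<close> enough room
  for deleting an edge \<open>xy\<close> directed from \<open>y\<close> to \<open>x\<close>.\<close>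
lemma not_all_out:
  assumes no: "\<And>x. x \<in> V \<Longrightarrow> \<not> in_ok x" shows False
proof -
  have q0: "q x = 0" if "x \<in> V" for x using out_arc_removable not_blocked no that by blast
  then have sq: "sum q V = 0" by simp
  \<comment> \<open>The sum is at most 4 + 3; the values 6 and 7 fail because their distances are 0
    and 1.\<close>
  have small: "sum p V \<le> 5"
    using boundary sq rdist_bounds(2)[of "sum p V"] rdist_values rdist_cong[of 6 0]
    by (smt (verit) diff_0 rdist_minus rdist_cong dvd_refl rdist_values(1,2,9))
  obtain x where x: "x \<in> V" "1 \<le> p x"
  proof (cases "\<exists>x\<in>V. 1 \<le> p x")
    case False
    then have p0: "p x = 0" if "x \<in> V" for x using p_nonneg[of x] that by fastforce
    obtain x where x: "x \<in> V" using card_V by fastforce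
    \<comment> \<open>Without arcs, x and its complement have equal degree and distance, but x is
      tight and the complement has slack two.\<close>
    have "tot E u v p q (V - {x}) = tot E u v p q {x}"
      using cut_compl[of E u V v "{x}"] ends p0 q0 x by (simp add: tot_def)
    moreover have "rdist (tgt s p q (V - {x})) = rdist (tgt s p q {x})"
      using p0 q0 x sum_s by (intro rdist_eq_of_dvd_add) (simp add: tgt_def sum_delete_vertex)
    moreover have "6 + rdist (tgt s p q (V - {x})) \<le> tot E u v p q (V - {x})"
      using x card_V_ge_3 finV by (intro slack_ge_2) auto
    ultimately show ?thesis using tight_values(1)[OF x no[OF x]] by simp
  qed (use that in blast)
  obtain e where e: "e \<in> E" "(u e \<in> {x}) \<noteq> (v e \<in> {x})"
    using connected[of "{x}"] singleton_psubset[OF x(1)] by blast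
  obtain y where y: "{u e, v e} = {x, y}" "y \<noteq> x" "y \<in> V" using edge_at[OF e] .
  \<comment> \<open>The conclusion concerns E alone, so arcs may be exchanged as long as feasibility
    survives. At x the degree is unchanged and \<open>tgt\<close> grows by 1 + 3 = 4, that is by -2
    modulo 6, which takes the residues 1 and 2 to -1 and 0, no farther from 0.\<close>
  let ?s = "add_at x 1 (add_at y (-1) s)" and ?p = "add_at x (-1) p" and ?q = "add_at x 2 q"
  have cut: "cut_size (E - {e}) u v A = cut_size E u v A - of_bool ((x \<in> A) \<noteq> (y \<in> A))" for A
    using cut_remove[OF finE e(1), of u v A] y(1) by (auto simp: doubleton_eq_iff)
  have "orientable V (E - {e}) u v ?s"
  proof (rule minimal)
    show "feasible V (E - {e}) u v ?s ?p ?q"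
      unfolding feasible_def
    proof (intro conjI ballI allI impI)
      fix z assume "z \<in> V"
      then show "even (cut_size (E - {e}) u v {z} + ?s z)"
        using even_deg[of z] y by (auto simp: cut add_at_def)
    next
      show "6 dvd sum ?s V" using sum_s x y by (simp add: sum_add_at finV)
    next
      \<comment> \<open>The bound on \<open>z0\<close> becomes
        \<open>sum p V + 1 \<le> 7 - rdist (sum p V)\<close>, which holds for each of the values 1
        to 5.\<close>
      have "rdist (3 - sum p V) = 3 - rdist (sum p V)"
        using rdist_add3[of "- sum p V"] by (simp add: rdist_minus)
      moreover have "1 \<le> sum p V"
        using x finV p_nonneg member_le_sum[of x V p] by auto
      then have "sum p V \<in> {1, 2, 3, 4, 5}" using small by auto
      ultimately show "sum ?p V + sum ?q V \<le> 4 + rdist (sum ?q V - sum ?p V)"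
        using x finV sq by (auto simp: sum_add_at rdist_values)
    next
      fix A assume A: "A \<noteq> {}" "A \<subset> V"
      have fA: "finite A" using A finite_sub by auto
      have tgt: "tgt ?s ?p ?q A = tgt s p q A + 4 * of_bool (x \<in> A) - of_bool (y \<in> A)"
        by (simp add: tgt_def sum_add_at fA)
      have tot: "tot (E - {e}) u v ?p ?q A = tot E u v p q A + of_bool (x \<in> A) - of_bool ((x \<in> A) \<noteq> (y \<in> A))"
        by (simp add: tot_def cut sum_add_at fA)
      have r4: "rdist (k + 4) = rdist (k - 2)" for k by (rule rdist_cong) simp
      have r2: "rdist (k - 2) \<le> rdist k + 2" for k
        using rdist_steps_le(2)[of k] rdist_steps_le(2)[of "k - 1"] by simp
      from A show "4 + rdist (tgt ?s ?p ?q A) \<le> tot (E - {e}) u v ?p ?q A"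
      proof (cases rule: singleton_or_large)
        case (1 z)
        then have z: "z \<in> V" using A by blast
        note tv = tight_values[OF z no[OF z]]
        have "rdist (tgt s p q {z} - 2) \<le> rdist (tgt s p q {z})" "rdist (tgt s p q {z} - 1) = rdist (tgt s p q {z}) - 1"
          using tv(2) rdist_mod_add[of "tgt s p q {z}" "-2"] rdist_mod_add[of "tgt s p q {z}" "-1"]
            rdist_mod_add[of "tgt s p q {z}" 0]
          by (auto simp: rdist_values)
        then show ?thesis using 1 y tv(1) unfolding tgt tot by (auto simp: r4)
      next
        case 2
        let ?t = "tgt s p q A"
        have "rdist (3 + ?t) \<le> 3" by (rule rdist_bounds)
        then show ?thesis
          using slack_ge_2[OF A(2) 2] rdist_steps_le[of ?t] r2[of ?t] rdist_bounds(1)[of ?t]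
          unfolding tgt tot by (auto simp: r4)
      qed
    qed (use finV finE card_V ends p_nonneg q_nonneg x in \<open>auto simp: add_at_def\<close>)
    have "card (E - {e}) + 1 = card E" using e(1) finE card_gt_0_iff[of E] by auto
    then show "weight V (E - {e}) ?p ?q < weight V E p q"
      using x finV by (simp add: weight_def sum_add_at)
  qed
  moreover have "{u e, v e} = {y, x}" using y by auto
  ultimately show False using orientable_delete[of E e u v y x] finE e not_orientable by blast
qed

end

section \<open>Reversal symmetry and the final contradiction\<close>

lemma net_uminus: "net E u v (\<lambda>e. - w e) x = - net E u v w x"
  unfolding net_def by (simp add: sum_negf)

lemma orientable_uminus:
  assumes "orientable V E u v s" shows "orientable V E u v (\<lambda>x. - s x)"
proof -
  obtain w where w: "\<forall>e. w e = 1 \<or> w e = -1" "\<forall>z\<in>V. 3 dvd net E u v w z - s z"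
    using assms unfolding orientable_def by blast
  have "3 dvd net E u v (\<lambda>e. - w e) z - - s z" if "z \<in> V" for z
    using bspec[OF w(2) that] unfolding net_uminus by presburger
  moreover have "\<forall>e. - w e = 1 \<or> - w e = -1" using w(1) by (metis minus_minus)
  ultimately show ?thesis unfolding orientable_def by (intro exI[of _ "\<lambda>e. - w e"]) auto
qed

lemma tgt_uminus: "tgt (\<lambda>x. - s x) q p A = - tgt s p q A"
  by (simp add: tgt_def sum_negf)

lemma tot_swap: "tot E u v q p A = tot E u v p q A"
  by (simp add: tot_def)

lemma feasible_uminus: "feasible V E u v s p q \<Longrightarrow> feasible V E u v (\<lambda>x. - s x) q p"
  using rdist_minus[of "sum q V - sum p V"]
  unfolding feasible_def by (auto simp: tgt_uminus tot_swap rdist_minus sum_negf)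

context minimal_counterexample
begin

lemma reversed: "minimal_counterexample V E u v (\<lambda>x. - s x) q p"
proof
  show "feasible V E u v (\<lambda>x. - s x) q p" using feas by (rule feasible_uminus)
  show "\<not> orientable V E u v (\<lambda>x. - s x)"
    using orientable_uminus[of V E u v "\<lambda>x. - s x"] not_orientable by auto
  show "orientable V' E' u' v' s'"
    if "feasible V' E' u' v' s' p' q'" "weight V' E' p' q' < weight V E q p"
    for V' :: "'v set" and E' :: "'e set" and u' v' s' p' q'
    using that by (intro minimal) (auto simp: weight_def)
qed

lemma reversed_in_ok: "minimal_counterexample.in_ok E u v (\<lambda>x. - s x) q p x \<longleftrightarrow> out_ok x"
  using rdist_minus[of "tgt s p q {x} - 1"]
  by (simp add: minimal_counterexample.in_ok_def[OF reversed] out_ok_def tot_swap tgt_uminus)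

text \<open>If \<open>out_ok\<close> holds at one end of an edge, \<open>edge_blocked\<close>
  excludes \<open>in_ok\<close> at the other, which is then \<open>out_ok\<close> by
  \<open>not_blocked\<close>. So \<open>out_ok\<close> spreads over the connected graph and holds
  everywhere or nowhere; \<open>not_all_out\<close> and its reversal refute both.\<close>

lemma absurd: False
proof -
  have nbr: "out_ok y" if "e \<in> E" "{u e, v e} = {x, y}" "out_ok x" for e x y
    using edge_blocked[OF that(1,2,3)] not_blocked[OF edge_ends(2)[OF that(1,2)]] by blast
  let ?P = "{x \<in> V. out_ok x}"
  have "?P = {} \<or> ?P = V"
  proof (rule ccontr)
    assume "\<not> ?thesis"
    then have "?P \<noteq> {}" "?P \<subset> V" by auto
    then obtain e where e: "e \<in> E" "(u e \<in> ?P) \<noteq> (v e \<in> ?P)" by (rule connected)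
    then show False using nbr[of e "u e" "v e"] nbr[of e "v e" "u e"] ends[of e] by (auto simp: insert_commute)
  qed
  then show False
  proof
    assume "?P = {}"
    then show False
      using minimal_counterexample.not_all_out[OF reversed] unfolding reversed_in_ok by blast
  next
    assume P: "?P = V"
    show False
    proof (rule not_all_out)
      fix x assume x: "x \<in> V"
      obtain e where e: "e \<in> E" "(u e \<in> {x}) \<noteq> (v e \<in> {x})"
        using connected[of "{x}"] singleton_psubset[OF x] by blast
      obtain y where y: "{u e, v e} = {x, y}" "y \<noteq> x" "y \<in> V" using edge_at[OF e] .
      then have "{u e, v e} = {y, x}" "out_ok y" using P by auto
      then show "\<not> in_ok x" using edge_blocked[OF e(1)] by blast
    qed
  qed
qed

end

section \<open>Consequence for graphs without small cuts\<close>

theorem feasible_orientable: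
  "feasible V E u v s p q \<Longrightarrow> orientable V E u v s"
proof (induction "nat (weight V E p q)" arbitrary: V E u v s p q rule: less_induct)
  case less
  show ?case
  proof (rule ccontr)
    assume no: "\<not> orientable V E u v s"
    have "minimal_counterexample V E u v s p q"
    proof
      fix V' :: "'a set" and E' :: "'b set" and u' v' s' p' q'
      assume *: "feasible V' E' u' v' s' p' q'" "weight V' E' p' q' < weight V E p q"
      have "0 \<le> weight V' E' p' q'" using *(1) by (auto simp: weight_def feasible_def intro!: add_nonneg_nonneg sum_nonneg)
      then show "orientable V' E' u' v' s'" using * by (intro less(1)) auto
    qed (use less no in auto)
    then show False by (rule minimal_counterexample.absurd)
  qed
qed

lemma orientable_of_cuts_ge_6:
  assumes fin: "finite V" "finite E" and V: "2 \<le> card V"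
    and ends: "\<And>e. e \<in> E \<Longrightarrow> u e \<in> V \<and> v e \<in> V"
    and cut: "\<And>A. A \<noteq> {} \<Longrightarrow> A \<subset> V \<Longrightarrow> 6 \<le> cut_size E u v A"
    and s: "3 dvd sum s V"
  shows "orientable V E u v s"
proof -
  \<comment> \<open>Adding 3 where needed matches the parity of the degree and keeps the residue
    modulo 3.\<close>
  define s' where "s' x = s x + 3 * of_bool (odd (cut_size E u v {x} + s x))" for x
  have par: "even (cut_size E u v {x} + s' x)" for x by (simp add: s'_def)
  have parA: "even (cut_size E u v A + sum s' A)" if "finite A" for A
  proof -
    have "even (\<Sum>x\<in>A. cut_size E u v {x} + s' x)" by (intro dvd_sum par)
    then show ?thesis using even_cut_sum[OF that, of E u v] by (simp add: sum.distrib)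
  qed
  have "cut_size E u v V = 0" unfolding cut_size_def using ends by (intro sum.neutral) auto
  then have "even (sum s' V)" using parA[OF fin(1)] by simp
  moreover have "3 dvd sum s' V"
    using s unfolding s'_def by (simp add: sum.distrib sum_distrib_left[symmetric] del: sum_of_bool_eq)
  ultimately have s6: "6 dvd sum s' V" by presburger
  have "feasible V E u v s' (\<lambda>_. 0) (\<lambda>_. 0)"
    unfolding feasible_def
  proof (intro conjI ballI allI impI)
    fix A assume A: "A \<noteq> {}" "A \<subset> V"
    have "finite A" using A fin finite_subset by blast
    then have "even (cut_size E u v A + rdist (sum s' A))"
      using parA[of A] even_rdist[of "sum s' A"] by auto
    moreover have "6 \<le> cut_size E u v A" "rdist (sum s' A) \<le> 3" using cut[OF A] rdist_bounds by auto
    \<comment> \<open>Distance 3 would demand seven edges, but it also makes the cut odd, so six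
      edges become seven.\<close>
    ultimately have "4 + rdist (sum s' A) \<le> cut_size E u v A" by presburger
    then show "4 + rdist (tgt s' (\<lambda>_. 0) (\<lambda>_. 0) A) \<le> tot E u v (\<lambda>_. 0) (\<lambda>_. 0) A"
      by (simp add: tgt_def tot_def)
  qed (use fin V ends par s6 in \<open>auto simp: rdist_values\<close>)
  then have "orientable V E u v s'" by (rule feasible_orientable)
  then show ?thesis by (rule orientable_mod) (simp add: s'_def)
qed

section \<open>Four disjoint connected spanning edge sets\<close>

text \<open>Connectedness in terms of cuts passes directly to contractions, since their cuts are
  cuts of the original graph.\<close>

definition connects :: "'v set \<Rightarrow> 'e set \<Rightarrow> ('e \<Rightarrow> 'v) \<Rightarrow> ('e \<Rightarrow> 'v) \<Rightarrow> bool" where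
  "connects V F u v \<longleftrightarrow> (\<forall>A. A \<noteq> {} \<longrightarrow> A \<subset> V \<longrightarrow> (\<exists>e\<in>F. (u e \<in> A) \<noteq> (v e \<in> A)))"

lemma connects_cut_size:
  "connects V F u v \<Longrightarrow> A \<noteq> {} \<Longrightarrow> A \<subset> V \<Longrightarrow> finite F \<Longrightarrow> 1 \<le> cut_size F u v A"
  unfolding connects_def by (simp add: cut_pos_iff)

definition packing :: "'v set \<Rightarrow> 'e set \<Rightarrow> ('e \<Rightarrow> 'v) \<Rightarrow> ('e \<Rightarrow> 'v) \<Rightarrow> (nat \<Rightarrow> 'e set) \<Rightarrow> bool" where
  "packing V E u v F \<longleftrightarrow> (\<forall>i<4. F i \<subseteq> E \<and> connects V (F i) u v) \<and>
     (\<forall>i<4. \<forall>j<4. i \<noteq> j \<longrightarrow> F i \<inter> F j = {})"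

lemma packingD:
  assumes "packing V E u v F" "i < 4"
  shows "F i \<subseteq> E" "connects V (F i) u v" "finite E \<Longrightarrow> finite (F i)"
  using assms finite_subset[of "F i" E] unfolding packing_def by simp_all

lemma packing_disjoint:
  "packing V E u v F \<Longrightarrow> i < 4 \<Longrightarrow> j < 4 \<Longrightarrow> i \<noteq> j \<Longrightarrow> F i \<inter> F j = {}"
  unfolding packing_def by simp

lemma connects_induced_exit:
  assumes "connects V F u v" "X \<noteq> {}" "X \<subseteq> A" "A \<subset> V"
    and none: "\<And>e. e \<in> induced F u v A \<Longrightarrow> (u e \<in> X) = (v e \<in> X)"
  obtains e where "e \<in> F" "u e \<in> X \<and> v e \<notin> A \<or> v e \<in> X \<and> u e \<notin> A"
proof -
  have "X \<subset> V" using assms(3,4) by auto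
  then obtain e where e: "e \<in> F" "(u e \<in> X) \<noteq> (v e \<in> X)"
    using assms(1,2) unfolding connects_def by meson
  have "\<not> (u e \<in> A \<and> v e \<in> A)" using none[of e] e by (auto simp: induced_def)
  then show thesis using e assms(3) by (intro that[of e]) auto
qed

lemma not_connects_induced:
  assumes "connects V F u v" "A \<subset> V" "\<not> connects A (induced F u v A) u v"
  obtains X e f where "X \<noteq> {}" "X \<subset> A" "e \<in> F" "f \<in> F"
    "u e \<in> X \<and> v e \<notin> A \<or> v e \<in> X \<and> u e \<notin> A"
    "u f \<in> A - X \<and> v f \<notin> A \<or> v f \<in> A - X \<and> u f \<notin> A"
    "\<And>g. g \<in> induced F u v A \<Longrightarrow> (u g \<in> X) = (v g \<in> X)"
proof -
  obtain X where X: "X \<noteq> {}" "X \<subset> A" "\<And>g. g \<in> induced F u v A \<Longrightarrow> (u g \<in> X) = (v g \<in> X)"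
    using assms(3) unfolding connects_def by metis
  obtain e where "e \<in> F" "u e \<in> X \<and> v e \<notin> A \<or> v e \<in> X \<and> u e \<notin> A"
    using connects_induced_exit[OF assms(1) X(1) _ assms(2) X(3)] X(2) by blast
  moreover have "(u g \<in> A - X) = (v g \<in> A - X)" if "g \<in> induced F u v A" for g
    using X(3)[OF that] that by (auto simp: induced_def)
  then obtain f where "f \<in> F" "u f \<in> A - X \<and> v f \<notin> A \<or> v f \<in> A - X \<and> u f \<notin> A"
    using connects_induced_exit[OF assms(1) _ _ assms(2), of "A - X"] X(2) by blast
  ultimately show thesis using X that by blast
qed

lemma cut_le_2D:
  assumes "finite F" "cut_size F u v A \<le> 2" "e \<in> F" "f \<in> F" "g \<in> F" "e \<noteq> f"
    "(u e \<in> A) \<noteq> (v e \<in> A)" "(u f \<in> A) \<noteq> (v f \<in> A)" "(u g \<in> A) \<noteq> (v g \<in> A)"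
  shows "g = e \<or> g = f"
proof (rule ccontr)
  assume "\<not> ?thesis"
  then have "card {e, f, g} = 3" using assms(6) by auto
  moreover have "card {e, f, g} \<le> card {e \<in> F. (u e \<in> A) \<noteq> (v e \<in> A)}"
    using assms by (intro card_mono) auto
  ultimately show False using assms(1,2) by (simp add: cut_eq_card)
qed

text \<open>If A fell apart, each of the two pieces would need an edge of its own leaving A.\<close>

lemma connects_induced_of_cut_1:
  assumes "connects V F u v" "A \<subset> V" "finite F" "cut_size F u v A = 1"
  shows "connects A (induced F u v A) u v"
proof (rule ccontr)
  assume no: "\<not> ?thesis"
  obtain X e f where X: "X \<subset> A" "e \<in> F" "f \<in> F"
    "u e \<in> X \<and> v e \<notin> A \<or> v e \<in> X \<and> u e \<notin> A"
    "u f \<in> A - X \<and> v f \<notin> A \<or> v f \<in> A - X \<and> u f \<notin> A"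
    using not_connects_induced[OF assms(1,2) no] by metis
  have "card {e, f} \<le> card {e \<in> F. (u e \<in> A) \<noteq> (v e \<in> A)}"
    using X assms(3) by (intro card_mono) auto
  moreover have "e \<noteq> f" using X by blast
  ultimately show False using assms(3,4) by (simp add: cut_eq_card)
qed

text \<open>If both sides fell apart, the two crossing edges would match up the pieces in
  two pairs, and the union of one pair would be a component.\<close>
lemma connects_induced_of_cut_2:
  assumes con: "connects V F u v" and A: "A \<noteq> {}" "A \<subset> V" and fin: "finite F"
    and ends: "\<And>e. e \<in> F \<Longrightarrow> u e \<in> V \<and> v e \<in> V" and cut: "cut_size F u v A \<le> 2"
  shows "connects A (induced F u v A) u v \<or> connects (V - A) (induced F u v (V - A)) u v"
proof (rule ccontr)
  assume "\<not> ?thesis"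
  then have no: "\<not> connects A (induced F u v A) u v" "\<not> connects (V - A) (induced F u v (V - A)) u v"
    by auto
  obtain X e f where X: "X \<noteq> {}" "X \<subset> A" "e \<in> F" "f \<in> F"
    "u e \<in> X \<and> v e \<notin> A \<or> v e \<in> X \<and> u e \<notin> A"
    "u f \<in> A - X \<and> v f \<notin> A \<or> v f \<in> A - X \<and> u f \<notin> A"
    "\<And>g. g \<in> induced F u v A \<Longrightarrow> (u g \<in> X) = (v g \<in> X)"
    using not_connects_induced[OF con A(2) no(1)] by metis
  have "V - A \<subset> V" using A by auto
  then obtain Y e' f' where Y: "Y \<noteq> {}" "Y \<subset> V - A" "e' \<in> F" "f' \<in> F"
    "u e' \<in> Y \<and> v e' \<notin> V - A \<or> v e' \<in> Y \<and> u e' \<notin> V - A"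
    "u f' \<in> V - A - Y \<and> v f' \<notin> V - A \<or> v f' \<in> V - A - Y \<and> u f' \<notin> V - A"
    "\<And>g. g \<in> induced F u v (V - A) \<Longrightarrow> (u g \<in> Y) = (v g \<in> Y)"
    using not_connects_induced[OF con _ no(2)] by metis
  have ef: "e \<noteq> f" using X by blast
  have cr: "(u e \<in> A) \<noteq> (v e \<in> A)" "(u f \<in> A) \<noteq> (v f \<in> A)" using X by blast+
  have all: "g = e \<or> g = f" if "g \<in> F" "(u g \<in> A) \<noteq> (v g \<in> A)" for g
    using cut_le_2D[OF fin cut X(3,4) that(1) ef cr that(2)] .
  have "e' = e \<or> e' = f" "f' = e \<or> f' = f" "e' \<noteq> f'"
    using all[of e'] all[of f'] Y ends[of e'] ends[of f'] by blast+
  then consider "e' = e" "f' = f" | "e' = f" "f' = e" by blast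
  then obtain Z where Z: "Z \<noteq> {}" "Z \<subset> V" "\<And>g. g \<in> F \<Longrightarrow> (u g \<in> Z) = (v g \<in> Z)"
  proof cases
    case 1
    have "(u g \<in> X \<union> Y) = (v g \<in> X \<union> Y)" if g: "g \<in> F" for g
    proof (cases "(u g \<in> A) = (v g \<in> A)")
      case True
      then show ?thesis using X(2) X(7)[of g] Y(2) Y(7)[of g] ends[OF g] g unfolding induced_def by blast
    next
      case False
      then show ?thesis using all[OF g] X(2,5,6) Y(2,5,6) 1 by blast
    qed
    then show thesis using that[of "X \<union> Y"] X(1,2) Y(2) A by blast
  next
    case 2
    have "(u g \<in> X \<union> (V - A - Y)) = (v g \<in> X \<union> (V - A - Y))" if g: "g \<in> F" for g
    proof (cases "(u g \<in> A) = (v g \<in> A)")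
      case True
      then show ?thesis using X(2) X(7)[of g] Y(2) Y(7)[of g] ends[OF g] g unfolding induced_def by blast
    next
      case False
      then show ?thesis using all[OF g] X(2,5,6) Y(2,5,6) 2 by blast
    qed
    then show thesis using that[of "X \<union> (V - A - Y)"] X(1,2) Y(1,2) A by blast
  qed
  then show False using con unfolding connects_def by blast
qed

lemma connects_collapse:
  assumes "connects V F u v" "a \<in> A" "A \<subseteq> V"
  shows "connects (insert a (V - A)) F (collapse A a \<circ> u) (collapse A a \<circ> v)"
  unfolding connects_def
proof (intro allI impI)
  fix B assume B: "B \<noteq> {}" "B \<subset> insert a (V - A)"
  let ?X = "if a \<in> B then B \<union> A else B - A"
  have "?X \<noteq> {}" "?X \<subset> V" using B assms(2,3) by auto
  then obtain e where "e \<in> F" "(u e \<in> ?X) \<noteq> (v e \<in> ?X)"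
    using assms(1) unfolding connects_def by blast
  then show "\<exists>e\<in>F. ((collapse A a \<circ> u) e \<in> B) \<noteq> ((collapse A a \<circ> v) e \<in> B)"
    using B assms(2) by (intro bexI[of _ e]) (auto simp: collapse_def split: if_splits)
qed

section \<open>Vertex extension and small cuts of a packing\<close>

text \<open>Contracting everything except x leaves two vertices joined by two parallel
  edges.\<close>

lemma orientable_add_vertex:
  assumes fin: "finite V" "finite E" and x: "x \<in> V"
    and ends: "\<And>e. e \<in> E \<Longrightarrow> u e \<in> V \<and> v e \<in> V" and cut: "2 \<le> cut_size E u v {x}"
    and inner: "\<And>s'. 3 dvd sum s' (V - {x}) \<Longrightarrow> orientable (V - {x}) (induced E u v (V - {x})) u v s'"
    and s: "3 dvd sum s V"
  shows "orientable V E u v s"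
proof -
  obtain e f where ef: "e \<in> E" "f \<in> E" "e \<noteq> f" "(u e \<in> {x}) \<noteq> (v e \<in> {x})" "(u f \<in> {x}) \<noteq> (v f \<in> {x})"
    using cut_ge_2E[OF fin(2) cut] .
  let ?C = "V - {x}"
  obtain a where a: "a \<in> ?C" using ends[OF ef(1)] ef(4) by auto
  let ?u = "collapse ?C a \<circ> u" and ?v = "collapse ?C a \<circ> v"
  have "orientable {x, a} E ?u ?v (merge ?C a s)"
  proof (rule orientable_two_vertices[OF fin(2) _ ef(1,2,3)])
    show "x \<noteq> a" using a by auto
    show "{?u e, ?v e} = {x, a}" using ends[OF ef(1)] ef(4) by (auto simp: collapse_def)
    show "{?u f, ?v f} = {x, a}" using ends[OF ef(2)] ef(5) by (auto simp: collapse_def)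
    show "?u g \<in> {x, a} \<and> ?v g \<in> {x, a}" if "g \<in> E" for g
      using ends[OF that] by (auto simp: collapse_def)
    have "merge ?C a s x + merge ?C a s a = sum s V"
      using a x fin by (auto simp: merge_def sum.remove)
    then show "3 dvd merge ?C a s x + merge ?C a s a" using s by simp
  qed
  moreover have "{x, a} = insert a (V - ?C)" using x a by auto
  ultimately show ?thesis
    using inner fin a by (intro orientable_contract[of E V ?C a]) auto
qed

text \<open>Each of the four sets crosses at least once, so at most one of them crosses twice. The
  last inequality says that two crossing edges lie outside \<open>F i\<close>; these remain at x
  after a pair has been split off.\<close>

lemma packing_cuts:
  assumes fin: "finite E" and F: "packing V E u v F" and A: "A \<noteq> {}" "A \<subset> V"
    and cut: "cut_size E u v A \<le> 5"
  obtains i where "i < 4" "cut_size (F i) u v A \<le> 2"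
    "\<And>j. j < 4 \<Longrightarrow> j \<noteq> i \<Longrightarrow> cut_size (F j) u v A = 1"
    "2 + cut_size (F i) u v A \<le> cut_size E u v A"
proof -
  note sub = packingD(1)[OF F] packingD(3)[OF F _ fin]
  have "cut_size (\<Union>i\<in>{..<4}. F i) u v A = (\<Sum>i<4. cut_size (F i) u v A)"
    unfolding cut_size_def using sub packing_disjoint[OF F] by (intro sum.UNION_disjoint) auto
  moreover have "cut_size (\<Union>i\<in>{..<4}. F i) u v A \<le> cut_size E u v A"
    unfolding cut_size_def using sub fin by (intro sum_mono2) auto
  ultimately have le: "cut_size (F 0) u v A + cut_size (F 1) u v A + cut_size (F 2) u v A
      + cut_size (F 3) u v A \<le> cut_size E u v A"
    by (simp add: eval_nat_numeral)
  have ge: "1 \<le> cut_size (F i) u v A" if "i < 4" for i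
    using connects_cut_size[OF packingD(2)[OF F that] A sub(2)[OF that]] .
  have lt: "i = 0 \<or> i = 1 \<or> i = 2 \<or> i = 3" if "i < 4" for i :: nat using that by auto
  show thesis
  proof (cases "\<exists>i<4. 2 \<le> cut_size (F i) u v A")
    case True
    then obtain i where i: "i < 4" "2 \<le> cut_size (F i) u v A" by auto
    show thesis
    proof (rule that[OF i(1)])
      show "cut_size (F i) u v A \<le> 2" "2 + cut_size (F i) u v A \<le> cut_size E u v A"
        using lt[OF i(1)] le cut ge[of 0] ge[of 1] ge[of 2] ge[of 3] by auto
      show "cut_size (F j) u v A = 1" if "j < 4" "j \<noteq> i" for j
        using lt[OF i(1)] lt[OF that(1)] that(2) i(2) le cut ge[of 0] ge[of 1] ge[of 2] ge[of 3] by auto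
    qed
  next
    case False
    then have one: "cut_size (F i) u v A = 1" if "i < 4" for i using ge[OF that] that by force
    show thesis using that[of 0] one le by simp
  qed
qed

lemma packing_induced:
  assumes "packing V E u v F" "\<And>i. i < 4 \<Longrightarrow> connects A (induced (F i) u v A) u v"
  shows "packing A (induced E u v A) u v (\<lambda>i. induced (F i) u v A)"
  unfolding packing_def
proof (intro conjI allI impI)
  fix i j :: nat assume ij: "i < 4" "j < 4" "i \<noteq> j"
  show "induced (F i) u v A \<inter> induced (F j) u v A = {}"
    using packing_disjoint[OF assms(1) ij] by (auto simp: induced_def)
next
  fix i :: nat assume "i < 4"
  then show "induced (F i) u v A \<subseteq> induced E u v A" "connects A (induced (F i) u v A) u v"
    using packingD(1)[OF assms(1), of i] assms(2) by (auto simp: induced_def)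
qed

text \<open>The other sets have a single edge at x and survive its removal. If \<open>F i\<close>
  falls apart without x, each of the two parts was attached through its own one of \<open>e\<close>
  and \<open>f\<close>, so the new edge ab joins them.\<close>

lemma packing_split_vertex:
  assumes fin: "finite E" and ends: "\<And>e. e \<in> E \<Longrightarrow> u e \<in> V \<and> v e \<in> V"
    and F: "packing V E u v F" and x: "x \<in> V" "V \<noteq> {x}" and i: "i < 4"
    and other: "\<And>j. j < 4 \<Longrightarrow> j \<noteq> i \<Longrightarrow> cut_size (F j) u v {x} = 1"
    and two: "cut_size (F i) u v {x} \<le> 2"
    and ef: "e \<in> F i" "f \<in> F i" "e \<noteq> f" "{u e, v e} = {x, a}" "{u f, v f} = {x, b}" "a \<noteq> x" "b \<noteq> x"
  shows "packing (V - {x}) (induced (E - {f}) (u(e := a)) (v(e := b)) (V - {x})) (u(e := a)) (v(e := b))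
    (\<lambda>j. if j = i then insert e (induced (F i) u v (V - {x})) else induced (F j) u v (V - {x}))"
    (is "packing ?C ?E ?u ?v ?F")
proof -
  note sub = packingD(1,2)[OF F] packingD(3)[OF F _ fin]
  note dis = packing_disjoint[OF F]
  have C: "?C \<subset> V" using x by auto
  have inE: "e \<in> E" "f \<in> E" using ef sub[OF i] by auto
  have abC: "a \<in> ?C" "b \<in> ?C" using ends[OF inE(1)] ends[OF inE(2)] ef by (auto simp: doubleton_eq_iff)
  have cr: "(u e \<in> {x}) \<noteq> (v e \<in> {x})" "(u f \<in> {x}) \<noteq> (v f \<in> {x})" using ef by (auto simp: doubleton_eq_iff)
  have notind: "e \<notin> induced (F j) u v ?C" "f \<notin> induced (F j) u v ?C" for j
    using cr by (auto simp: induced_def)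
  have sub': "?F j \<subseteq> ?E" if "j < 4" for j
    using that sub[OF that] sub[OF i] ef inE abC notind by (auto simp: induced_def)
  have conj: "connects ?C (?F j) ?u ?v" if j: "j < 4" "j \<noteq> i" for j
  proof -
    have "cut_size (F j) u v ?C = 1"
      using other[OF j] cut_compl[of "F j" u V v "{x}"] ends sub(1)[OF j(1)] by auto
    then have "connects ?C (induced (F j) u v ?C) u v"
      using sub[OF j(1)] by (intro connects_induced_of_cut_1[OF _ C])
    moreover have "?u g = u g \<and> ?v g = v g" if "g \<in> induced (F j) u v ?C" for g
      using notind[of j] that by auto
    ultimately show ?thesis using j unfolding connects_def by (metis (no_types, lifting))
  qed
  have coni: "connects ?C (?F i) ?u ?v"
    unfolding connects_def
  proof (intro allI impI)
    fix Y assume Y: "Y \<noteq> {}" "Y \<subset> ?C"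
    show "\<exists>g\<in>?F i. (?u g \<in> Y) \<noteq> (?v g \<in> Y)"
    proof (cases "\<exists>g\<in>induced (F i) u v ?C. (u g \<in> Y) \<noteq> (v g \<in> Y)")
      case True
      then obtain g where g: "g \<in> induced (F i) u v ?C" "(u g \<in> Y) \<noteq> (v g \<in> Y)" by blast
      then have "g \<noteq> e" using notind by auto
      with g show ?thesis by (intro bexI[of _ g]) auto
    next
      case False
      then have none: "(u g \<in> Y) = (v g \<in> Y)" if "g \<in> induced (F i) u v ?C" for g using that by blast
      have none': "(u g \<in> ?C - Y) = (v g \<in> ?C - Y)" if "g \<in> induced (F i) u v ?C" for g
        using none[OF that] that unfolding induced_def by blast
      obtain g where g: "g \<in> F i" "u g \<in> Y \<and> v g \<notin> ?C \<or> v g \<in> Y \<and> u g \<notin> ?C"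
        using connects_induced_exit[OF sub(2)[OF i] Y(1) _ C none] Y(2) by blast
      obtain h where h: "h \<in> F i" "u h \<in> ?C - Y \<and> v h \<notin> ?C \<or> v h \<in> ?C - Y \<and> u h \<notin> ?C"
        using connects_induced_exit[OF sub(2)[OF i] _ _ C none'] Y(2) by blast
      have "(u g \<in> {x}) \<noteq> (v g \<in> {x})" "(u h \<in> {x}) \<noteq> (v h \<in> {x})"
        using g h ends[of g] ends[of h] sub(1)[OF i] Y by blast+
      then have "g = e \<or> g = f" "h = e \<or> h = f"
        using cut_le_2D[OF sub(3)[OF i] two ef(1,2) _ ef(3) cr] g(1) h(1) by blast+
      moreover have "g \<noteq> h" using g(2) h(2) Y by blast
      ultimately have "(a \<in> Y) \<noteq> (b \<in> Y)"
        using g(2) h(2) ef(4-7) Y x by (auto simp: doubleton_eq_iff)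
      then show ?thesis using ef(3) by (intro bexI[of _ e]) auto
    qed
  qed
  have "?F j \<inter> ?F k = {}" if "j < 4" "k < 4" "j \<noteq> k" for j k
    using dis[OF that] dis[OF i that(1)] dis[OF i that(2)] ef(1) that by (auto simp: induced_def)
  moreover have "?F j \<subseteq> ?E \<and> connects ?C (?F j) ?u ?v" if "j < 4" for j
    using sub'[OF that] conj[OF that] coni by (cases "j = i") blast+
  ultimately show ?thesis unfolding packing_def by blast
qed

section \<open>Induction on the number of vertices\<close>

theorem packing_orientable:
  fixes V :: "'v set" and E :: "'e set"
  assumes "finite V" "finite E" "V \<noteq> {}" "\<And>e. e \<in> E \<Longrightarrow> u e \<in> V \<and> v e \<in> V"
    and "packing V E u v F" "3 dvd sum s V"
  shows "orientable V E u v s"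
  using assms
proof (induction "card V" arbitrary: V E u v F s rule: less_induct)
  case less
  note fin = less.prems(1,2) and ends = less.prems(4) and F = less.prems(5) and s = less.prems(6)
  have IH: "orientable W D u' v' s'"
    if "W \<noteq> {}" "finite W" "card W < card V" "finite D" "\<And>e. e \<in> D \<Longrightarrow> u' e \<in> W \<and> v' e \<in> W"
      "packing W D u' v' F'" "3 dvd sum s' W" for W :: "'v set" and D :: "'e set" and u' v' F' s'
    using less.hyps[of W D u' v' F' s'] that by blast
  have IHi: "orientable W (induced D u' v' W) u' v' s'"
    if "W \<noteq> {}" "finite W" "card W < card V" "finite D" "packing W (induced D u' v' W) u' v' F'" "3 dvd sum s' W"
    for W :: "'v set" and D :: "'e set" and u' v' F' s'
    using that by (intro IH[where F' = F']) (auto simp: induced_def)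
  consider (single) "card V = 1" | (large) "2 \<le> card V" "\<And>A. A \<noteq> {} \<Longrightarrow> A \<subset> V \<Longrightarrow> 6 \<le> cut_size E u v A"
    | (small) A where "A \<noteq> {}" "A \<subset> V" "cut_size E u v A \<le> 5"
  proof -
    have "card V \<noteq> 0" using less.prems(1,3) by simp
    then have "card V = 1 \<or> 2 \<le> card V" by linarith
    moreover have "6 \<le> cut_size E u v A \<or> cut_size E u v A \<le> 5" for A by linarith
    ultimately show thesis using single large small by blast
  qed
  then show ?case
  proof cases
    case single
    then obtain x where V: "V = {x}" by (auto simp: card_1_singleton_iff)
    have "net E u v (\<lambda>_. 1) x = 0"
      unfolding net_def using ends V by (intro sum.neutral) auto
    then show ?thesis
      using s V unfolding orientable_def by (intro exI[of _ "\<lambda>_. 1"]) auto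
  next
    case large
    then show ?thesis using fin ends s by (intro orientable_of_cuts_ge_6) auto
  next
    case small
    obtain i where i: "i < 4" "cut_size (F i) u v A \<le> 2"
      "\<And>j. j < 4 \<Longrightarrow> j \<noteq> i \<Longrightarrow> cut_size (F j) u v A = 1"
      using packing_cuts[OF fin(2) F small] by metis
    note sub = packingD(1,2)[OF F] packingD(3)[OF F _ fin(2)]
    have endsF: "u e \<in> V \<and> v e \<in> V" if "j < 4" "e \<in> F j" for j e
      using ends sub(1)[OF that(1)] that by blast
    have compl: "cut_size (F j) u v (V - A) = cut_size (F j) u v A" if "j < 4" for j
      using endsF[OF that] by (rule cut_compl)
    \<comment> \<open>The side is chosen for \<open>F i\<close> only: the other sets cross once and
      stay connected on both sides.\<close>
    have "\<exists>B. B \<in> {A, V - A} \<and> connects B (induced (F i) u v B) u v"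
      using connects_induced_of_cut_2[OF sub(2)[OF i(1)] small(1,2) sub(3)[OF i(1)] endsF[OF i(1)] i(2)]
      by blast
    then obtain B where B: "B \<in> {A, V - A}" "connects B (induced (F i) u v B) u v" by blast
    have BV: "B \<noteq> {}" "B \<subset> V" using B small by auto
    have cutB: "cut_size E u v B \<le> 5" using B(1) small cut_compl[of E u V v A] ends by auto
    have "connects B (induced (F j) u v B) u v" if "j < 4" for j
    proof (cases "j = i")
      case False
      then have "cut_size (F j) u v B = 1" using i(3)[OF that] compl[OF that] B(1) by auto
      then show ?thesis using sub[OF that] BV by (intro connects_induced_of_cut_1) auto
    qed (use B in simp)
    then have packB: "packing B (induced E u v B) u v (\<lambda>j. induced (F j) u v B)"
      by (intro packing_induced[OF F])
    have finB: "finite B" "card B < card V" using BV fin finite_subset psubset_card_mono by auto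
    show ?thesis
    proof (cases "card B = 1")
      case False
      obtain a where a: "a \<in> B" using BV by auto
      have cB: "2 \<le> card B" using False finB BV card_0_eq[of B] by linarith
      let ?V = "insert a (V - B)" and ?u = "collapse B a \<circ> u" and ?v = "collapse B a \<circ> v"
      have "card ?V + card B = card V + 1"
        using a BV fin finB by (simp add: card_Diff_subset psubset_imp_subset card_mono less_imp_le)
      then have "card ?V < card V" using cB by simp
      moreover have "sum (merge B a s) ?V = sum s V"
      proof -
        have "?V \<union> B = V" using a BV by auto
        then show ?thesis using sum_merge[of B ?V a s] a fin finB by auto
      qed
      moreover have "packing ?V E ?u ?v F"
        using F connects_collapse[of V _ u v a B] a BV unfolding packing_def by auto
      moreover have "?u e \<in> ?V \<and> ?v e \<in> ?V" if "e \<in> E" for e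
        using ends[OF that] by (auto simp: collapse_def)
      ultimately have "orientable ?V E ?u ?v (merge B a s)"
        using fin s by (intro IH[where F' = F]) auto
      moreover have "orientable B (induced E u v B) u v s'" if "3 dvd sum s' B" for s'
        using IHi[OF BV(1) finB fin(2) packB that] .
      ultimately show ?thesis
        using orientable_contract[OF fin(2,1) psubset_imp_subset[OF BV(2)] a, of u v s] by blast
    next
      case True
      then obtain x where x: "B = {x}" by (auto simp: card_1_singleton_iff)
      then have xV: "x \<in> V" "V \<noteq> {x}" using BV by auto
      \<comment> \<open>Contracting a single vertex gains nothing. The cut at x is examined afresh
        to obtain also the count of edges at x outside the critical set.\<close>
      obtain k where k: "k < 4" "cut_size (F k) u v {x} \<le> 2"
        "\<And>j. j < 4 \<Longrightarrow> j \<noteq> k \<Longrightarrow> cut_size (F j) u v {x} = 1"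
        "2 + cut_size (F k) u v {x} \<le> cut_size E u v {x}"
        using packing_cuts[OF fin(2) F BV cutB] unfolding x by metis
      let ?C = "V - {x}"
      have C: "?C \<noteq> {}" "?C \<subset> V" "finite ?C" "card ?C < card V"
        using xV fin by (auto intro: psubset_card_mono simp del: card_Diff_insert card_Diff_singleton)
      show ?thesis
      proof (cases "2 \<le> cut_size (F k) u v {x}")
        case False
        then have one: "cut_size (F j) u v {x} \<le> 1" if "j < 4" for j
          using k(3)[OF that] by (cases "j = k") auto
        have "connects ?C (induced (F j) u v ?C) u v" if "j < 4" for j
        proof -
          have "1 \<le> cut_size (F j) u v {x}"
            using connects_cut_size[OF sub(2)[OF that] BV sub(3)[OF that]] unfolding x .
          then have "cut_size (F j) u v ?C = 1"
            using one[OF that] cut_compl[of "F j" u V v "{x}"] endsF[OF that] by simp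
          then show ?thesis using sub[OF that] C by (intro connects_induced_of_cut_1) auto
        qed
        then have "packing ?C (induced E u v ?C) u v (\<lambda>j. induced (F j) u v ?C)"
          by (intro packing_induced[OF F])
        then have "orientable ?C (induced E u v ?C) u v s'" if "3 dvd sum s' ?C" for s'
          using IHi[OF C(1,3,4) fin(2) _ that] by blast
        moreover have "2 \<le> cut_size E u v {x}" using k(4) cut_nonneg[of "F k" u v "{x}"] by simp
        ultimately show ?thesis using ends s by (intro orientable_add_vertex[OF fin xV(1)]) auto
      next
        case True
        obtain e f where ef: "e \<in> F k" "f \<in> F k" "e \<noteq> f" "(u e \<in> {x}) \<noteq> (v e \<in> {x})" "(u f \<in> {x}) \<noteq> (v f \<in> {x})"
          using cut_ge_2E[OF sub(3)[OF k(1)] True] .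
        obtain a where a: "{u e, v e} = {x, a}" "a \<noteq> x" using ef(4) by (cases "u e = x") auto
        obtain b where b: "{u f, v f} = {x, b}" "b \<noteq> x" using ef(5) by (cases "u f = x") auto
        let ?u = "u(e := a)" and ?v = "v(e := b)" and ?E = "E - {f}"
        have inE: "e \<in> E" "f \<in> E" using ef sub(1)[OF k(1)] by auto
        have abV: "a \<in> V" "b \<in> V" using ends[OF inE(1)] ends[OF inE(2)] a b by (auto simp: doubleton_eq_iff)
        have "orientable V ?E ?u ?v s"
        proof (rule orientable_add_vertex[OF fin(1) _ xV(1)])
          \<comment> \<open>There are at least four edges at x, and the splitting uses up
            two.\<close>
          show "2 \<le> cut_size ?E ?u ?v {x}"
            using cut_split[OF fin(2) inE ef(3) a(1) b(1), of "{x}"] a b k(4) True by simp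
          show "?u g \<in> V \<and> ?v g \<in> V" if "g \<in> ?E" for g using that ends[of g] abV by auto
          show "orientable ?C (induced ?E ?u ?v ?C) ?u ?v s'" if "3 dvd sum s' ?C" for s'
            using IHi[OF C(1,3,4) _ _ that]
              packing_split_vertex[OF fin(2) ends F xV k(1,3,2) ef(1,2,3) a(1) b(1) a(2) b(2)] fin(2)
            by blast
        qed (use fin s in auto)
        then show ?thesis by (rule orientable_split[OF fin(2) inE ef(3) a(1) b(1)])
      qed
    qed
  qed
qed

section \<open>Translation from multigraphs and spanning trees\<close>

lemma mwalk_crosses:
  assumes "mwalk T x p y" "x \<in> A" "y \<notin> A"
  shows "\<exists>e\<in>medges T. \<exists>a b. mends T e = {a, b} \<and> a \<in> A \<and> b \<notin> A"
  using assms
proof (induction p arbitrary: x)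
  case (Cons c p)
  obtain e w where c: "c = (e, w)" by (cases c)
  show ?case
  proof (cases "w \<in> A")
    case True
    then show ?thesis using Cons.IH[of w] Cons.prems c by auto
  next
    case False
    then show ?thesis using Cons.prems c by auto
  qed
qed simp

lemma mspanning_tree_connects:
  assumes T: "mspanning_tree T G"
    and uv: "\<And>e. e \<in> medges G \<Longrightarrow> mends G e = {u e, v e}"
  shows "connects (mverts G) (medges T) u v"
  unfolding connects_def
proof (intro allI impI)
  fix A assume A: "A \<noteq> {}" "A \<subset> mverts G"
  then obtain x y where xy: "x \<in> A" "y \<notin> A" "x \<in> mverts G" "y \<in> mverts G" by blast
  have sub: "msubgraph T G" "mverts T = mverts G" "mconnected T"
    using T unfolding mspanning_tree_def mtree_def by auto
  have "\<exists>p. mwalk T x p y" using sub(2,3) xy(3,4) unfolding mconnected_def by simp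
  then obtain p where p: "mwalk T x p y" ..
  then obtain e a b where e: "e \<in> medges T" "mends T e = {a, b}" "a \<in> A" "b \<notin> A"
    using mwalk_crosses[OF p xy(1,2)] by blast
  then have "{u e, v e} = {a, b}" using sub uv unfolding msubgraph_def by auto
  then show "\<exists>e\<in>medges T. (u e \<in> A) \<noteq> (v e \<in> A)"
    using e by (intro bexI[of _ e]) (auto simp: doubleton_eq_iff)
qed

lemma of_int_3_eq_0_iff: "(of_int k :: 3) = 0 \<longleftrightarrow> 3 dvd k"
proof -
  have "(of_int k :: 3) = of_int (3 * (k div 3) + k mod 3)" by simp
  also have "\<dots> = of_int (k mod 3)"
  proof -
    have "(3 :: 3) = 0" by simp
    then show ?thesis by (simp only: of_int_add of_int_mult of_int_numeral mult_zero_left add_0)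
  qed
  finally have k: "(of_int k :: 3) = of_int (k mod 3)" .
  have "k mod 3 \<in> {0, 1, 2}" using pos_mod_sign[of 3 k] pos_mod_bound[of 3 k] by auto
  then show ?thesis unfolding k by (auto simp: dvd_eq_mod_eq_0)
qed

lemma net_eq_degrees:
  assumes fin: "finite E" and w: "\<forall>e. w e = 1 \<or> w e = -1"
    and D: "arcs D = E" "\<And>e. tail D e = (if w e = 1 then u e else v e)" "\<And>e. head D e = (if w e = 1 then v e else u e)"
  shows "net E u v w x = int (out_degree D x) - int (in_degree D x)"
proof -
  have "int (out_degree D x) = (\<Sum>e\<in>E. of_bool (tail D e = x))"
    unfolding out_degree_def out_arcs_def D(1) using fin by (simp add: Int_def)
  moreover have "int (in_degree D x) = (\<Sum>e\<in>E. of_bool (head D e = x))"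
    unfolding in_degree_def in_arcs_def D(1) using fin by (simp add: Int_def)
  moreover have "net E u v w x = (\<Sum>e\<in>E. of_bool (tail D e = x) - of_bool (head D e = x))"
    unfolding net_def D(2,3) using w by (intro sum.cong) force+
  ultimately show ?thesis by (simp add: sum_subtractf)
qed

theorem theorem1p7:
  fixes G :: "('a, 'e) multigraph"
  assumes "fin_loopless_multigraph G"
    and "has_edge_disjoint_spanning_trees 4 G"
  shows "Z3_connected G"
  unfolding Z3_connected_def
proof (intro allI impI)
  fix \<beta> :: "'a \<Rightarrow> 3"
  assume zs: "zero_sum G \<beta>"
  interpret fin_loopless_multigraph G by fact
  have "\<exists>a b. mends G e = {a, b}" if "e \<in> medges G" for e
    using card_mends[OF that] by (auto simp: card_2_iff)
  then obtain u v where uv: "\<And>e. e \<in> medges G \<Longrightarrow> mends G e = {u e, v e}" by metis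
  obtain T :: "nat \<Rightarrow> ('a, 'e) multigraph" where T: "\<And>i. i < (4 :: nat) \<Longrightarrow> mspanning_tree (T i) G"
    "\<And>i j. i < 4 \<Longrightarrow> j < 4 \<Longrightarrow> i \<noteq> j \<Longrightarrow> medges (T i) \<inter> medges (T j) = {}"
    using assms(2) unfolding has_edge_disjoint_spanning_trees_def by blast
  have pack: "packing (mverts G) (medges G) u v (\<lambda>i. medges (T i))"
    unfolding packing_def
  proof (intro conjI allI impI)
    fix i :: nat assume i: "i < 4"
    show "medges (T i) \<subseteq> medges G"
      using T(1)[OF i] unfolding mspanning_tree_def msubgraph_def by blast
    show "connects (mverts G) (medges (T i)) u v"
      using mspanning_tree_connects[OF T(1)[OF i] uv] .
  qed (use T(2) in blast)
  have ne: "mverts G \<noteq> {}"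
    using T(1)[of 0] unfolding mspanning_tree_def mtree_def mconnected_def by auto
  have "\<exists>k. of_int k = \<beta> x" for x
    by (rule bit1.cases[of "\<beta> x"]) metis
  then obtain s :: "'a \<Rightarrow> int" where s: "\<And>x. of_int (s x) = \<beta> x" by metis
  have "(of_int (sum s (mverts G)) :: 3) = 0"
    using zs by (simp add: zero_sum_def s)
  then have "3 dvd sum s (mverts G)" by (simp only: of_int_3_eq_0_iff)
  then have "orientable (mverts G) (medges G) u v s"
    using finite_mverts finite_medges ne pack mends_subset uv
    by (intro packing_orientable) auto
  then obtain w where w: "\<forall>e. w e = 1 \<or> w e = -1"
    "\<forall>x\<in>mverts G. 3 dvd net (medges G) u v w x - s x"
    unfolding orientable_def by blast
  define D where "D = \<lparr>verts = mverts G, arcs = medges G,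
    tail = (\<lambda>e. if w e = 1 then u e else v e), head = (\<lambda>e. if w e = 1 then v e else u e)\<rparr>"
  have "beta_orientation G \<beta> D"
    unfolding beta_orientation_def orientation_def
  proof (intro conjI ballI)
    fix x assume x: "x \<in> mverts G"
    have "net (medges G) u v w x = int (out_degree D x) - int (in_degree D x)"
      using finite_medges w(1) by (rule net_eq_degrees) (simp_all add: D_def)
    then have "(of_int (int (out_degree D x) - int (in_degree D x) - s x) :: 3) = 0"
      using bspec[OF w(2) x] by (simp only: of_int_3_eq_0_iff)
    then show "of_nat (out_degree D x) - of_nat (in_degree D x) = \<beta> x"
      by (simp add: s)
  qed (use uv in \<open>auto simp: D_def\<close>)
  then show "\<exists>D. beta_orientation G \<beta> D" by blast
qed

end
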